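(* Let $K\subseteq k((G))$ be a Hahn field with the first lifting property and the canonical second lifting property. Then \begin{align*} v\text{-}\mathrm{Aut}_{(k)}^{+}K &\simeq \big(\mathrm{Hom}^+(G,1+I_K)\rtimes \mathrm{Hom}(G,k^\times)\big)\rtimes(\mathrm{Aut}\,k\times o\text{-}\mathrm{Aut}\,G),\\ v\text{-}\mathrm{Aut}_{k}^{+}K &\simeq \big(\mathrm{Hom}^+(G,1+I_K)\rtimes \mathrm{Hom}(G,k^\times)\big)\rtimes o\text{-}\mathrm{Aut}\,G, \end{align*} where $\mathrm{Hom}^+(G,1+I_K)$ carries the operation $\times$ defined in the context.
   Context: Let $k$ be a field and $(G,+,<)$ a totally ordered abelian group. $\mathbb K=k((G))$ is the field of all formal series $a=\sum_{g\in G}a_gt^g$ ($a_g\in k$) whose support $\operatorname{supp}a=\{g:a_g\neq 0\}$ is well ordered, with termwise addition and convolution product. $k(G)\subseteq\mathbb K$ is the fraction field of the group ring $k[G]$ (series with finite support). A Hahn field is a field $K$ with $k(G)\subseteq K\subseteq \mathbb K$. It carries the valuation $v(a)=\min\operatorname{supp}a$ for $a\neq0$, $v(0)=\infty$, with value group $G$, and $I_K=\{a\in K:v(a)>0\}$; $1+I_K$ is the multiplicative group of 1-units. $\mathrm{Aut}\,k$ is the group of field automorphisms of $k$; $o\text{-}\mathrm{Aut}\,G$ is the group of order preserving automorphisms of $G$. $v\text{-}\mathrm{Aut}\,K$ is the group of valuation preserving automorphisms: field automorphisms $\sigma$ of $K$ for which there is $\tau\in o\text{-}\mathrm{Aut}\,G$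 with $\tau(v(a))=v(\sigma(a))$ for all $a\in K^\times$. For any group of automorphisms of $K$, the subscript $(k)$ denotes the subgroup of those $\sigma$ with $\sigma(k)=k$, the subscript $k$ the subgroup of those with $\sigma|_k=\mathrm{id}_k$. For $\sigma\in v\text{-}\mathrm{Aut}\,K$ let $\sigma_G\in o\text{-}\mathrm{Aut}\,G$, $\sigma_G(v(a))=v(\sigma(a))$, and $\sigma_k\in\mathrm{Aut}\,k$, $\sigma_k(c)=\sigma(c)_0$ (constant term) for $c\in k$. This gives a group homomorphism $\Phi\colon v\text{-}\mathrm{Aut}\,K\to\mathrm{Aut}\,k\times o\text{-}\mathrm{Aut}\,G$, $\sigma\mapsto(\sigma_k,\sigma_G)$. Put $\mathrm{IntAut}\,K:=\ker\Phi$. $K$ has the first lifting property if there is an injective group homomorphism $\Psi\colon \mathrm{Aut}\,k\times o\text{-}\mathrm{Aut}\,G\to v\text{-}\mathrm{Aut}\,K$ with $\Phi\Psi=\mathrm{id}$; such a $\Psi$ is fixed and $\mathrm{ExtAut}\,K:=\operatorname{im}\Psi$. Convention: if the maps $\sum a_gt^g\mapsto\sum\rho(a_g)t^{\tau(g)}$ send $K$ onto $K$ for all $(\rho,\tau)$, then $\Psi$ is chosen to assign to $(\rho,\tau)$ this map restricted to $K$. $\mathrm{Hom}(G,k^\times)$ is the group, under pointwise multiplication, of homomorphisms $x\colon(G,+)\to(k^\times,\cdot)$, $x^g:=x(g)$. $K$ has the canonical second lifting property if $x\mapsto\rho_x$, $\rho_x(\sum a_gt^g)=\sum a_gx^gt^g$,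 is a well defined group homomorphism $\mathrm{Hom}(G,k^\times)\to\mathrm{IntAut}\,K$. A family $\{a_{(i)}\}_{i\in I}\subseteq\mathbb K$ is summable if $\bigcup_i\operatorname{supp}a_{(i)}$ is well ordered and each $g$ lies in $\operatorname{supp}a_{(i)}$ for only finitely many $i$; its sum is then $\sum_ia_{(i)}:=\sum_g\big(\sum_i(a_{(i)})_g\big)t^g\in\mathbb K$. It is $K$-summable if it is a summable family of elements of $K$ whose sum lies in $K$. A map $\sigma\colon K\to K$ is $K$-summable if for every $a=\sum a_gt^g\in K$ the family $\{\sigma(a_gt^g):g\in\operatorname{supp}a\}$ is $K$-summable with sum $\sigma(a)$. $\sigma\in v\text{-}\mathrm{Aut}\,K$ is strongly additive if both $\sigma$ and $\sigma^{-1}$ are $K$-summable. The superscript $+$ on a group of automorphisms denotes its subset of strongly additive elements. $\mathrm{Hom}^+(G,1+I_K)$ is the set of group homomorphisms $u\colon(G,+)\to(1+I_K,\cdot)$ such that for every $a\in K$ the family $\{a_gu(g)t^g:g\in\operatorname{supp}a\}$ is $K$-summable. Its group operation is $(u\times w)(g)=\tau_u(w(g))\,u(g)$, where $\tau_u\colon K\to K$, $\tau_u(\sum a_gt^g)=\sum a_gu(g)t^g$. Semi-direct products are written with the normal factor on the left; the actions are those induced by conjugation of automorphisms via the identifications $u\mapsto\tau_u$, $x\mapsto\rho_x$ and $\mathrm{ExtAut}\,K\simeq\mathrm{Aut}\,k\times o\text{-}\mathrm{Aut}\,G$ (respectively $\mathrm{ExtAut}_kK\simeq o\text{-}\mathr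m{Aut}\,G$).
   Formalization: Added, as the claim can fail otherwise (e.g. K=Q(t)): v-Aut_(k)^+ K is a group; τ_u is a strongly additive automorphism of K for every u in Hom^+(G,1+I_K); and, if K lacks the canonical first lift, ExtAut K is contained in v-Aut_(k)^+ K. *)

theory Defs
  imports "HOL-Algebra.Algebra"
begin

section \<open>Hahn series\<close>

text \<open>A series over the coefficient field \<open>'k\<close> with exponents in \<open>'g\<close> is its coefficient
  function, so Hahn fields are subsets of \<open>'g \<Rightarrow> 'k\<close> and no field structure has to be proved on a
  new type.\<close>

type_synonym ('g, 'k) series = "'g \<Rightarrow> 'k"

definition well_ordered :: "'g::linorder set \<Rightarrow> bool" where
  "well_ordered S \<longleftrightarrow> (\<forall>T \<subseteq> S. T \<noteq> {} \<longrightarrow> (\<exists>m\<in>T. \<forall>x\<in>T. m \<le> x))"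

definition supp :: "('g, 'k::zero) series \<Rightarrow> 'g set" where
  "supp a = {g. a g \<noteq> 0}"

definition t_mono :: "'g \<Rightarrow> 'k::zero \<Rightarrow> ('g, 'k) series" where
  "t_mono g c = (\<lambda>h. if h = g then c else 0)"

text \<open>The ring \<open>k((G))\<close>. For well ordered supports the index set of the convolution is finite.\<close>

definition hahn :: "('g::linordered_ab_group_add, 'k::field) series ring" where
  "hahn = \<lparr>carrier = {a. well_ordered (supp a)},
           monoid.mult = (\<lambda>a b g. \<Sum>h\<in>{h. a h \<noteq> 0 \<and> b (g - h) \<noteq> 0}. a h * b (g - h)),
           monoid.one = t_mono 0 1,
           ring.zero = (\<lambda>_. 0),
           ring.add = (\<lambda>a b g. a g + b g)\<rparr>"

definition group_ring :: "('g::linordered_ab_group_add, 'k::field) series set" where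
  "group_ring = {a. finite (supp a)}"

definition group_ring_fractions :: "('g::linordered_ab_group_add, 'k::field) series set" where
  "group_ring_fractions =
     {p \<otimes>\<^bsub>hahn\<^esub> inv\<^bsub>hahn\<^esub> q | p q. p \<in> group_ring \<and> q \<in> group_ring \<and> q \<noteq> \<zero>\<^bsub>hahn\<^esub>}"

definition hahn_field :: "('g::linordered_ab_group_add, 'k::field) series set \<Rightarrow> bool" where
  "hahn_field K \<longleftrightarrow> subfield K hahn \<and> group_ring_fractions \<subseteq> K"

definition constants :: "('g::linordered_ab_group_add, 'k::field) series set" where
  "constants = range (t_mono 0)"

text \<open>\<open>val\<close> is only used for nonzero series; the value \<open>\<infinity>\<close> of the zero series is accounted for
  separately, as in \<open>pos_val\<close> below, which is \<open>I\<^sub>K\<close>.\<close>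

definition val :: "('g::linordered_ab_group_add, 'k::field) series \<Rightarrow> 'g" where
  "val a = (LEAST g. a g \<noteq> 0)"

definition pos_val :: "('g::linordered_ab_group_add, 'k::field) series set \<Rightarrow> ('g, 'k) series set" where
  "pos_val K = {a \<in> K. a = \<zero>\<^bsub>hahn\<^esub> \<or> 0 < val a}"

definition one_units :: "('g::linordered_ab_group_add, 'k::field) series set \<Rightarrow> ('g, 'k) series set" where
  "one_units K = {\<one>\<^bsub>hahn\<^esub> \<oplus>\<^bsub>hahn\<^esub> a | a. a \<in> pos_val K}"

section \<open>Automorphism groups\<close>

definition field_Aut :: "('k::field \<Rightarrow> 'k) monoid" where
  "field_Aut = (BijGroup UNIV)\<lparr>carrier :=
     {\<rho>. bij \<rho> \<and> (\<forall>x y. \<rho> (x + y) = \<rho> x + \<rho> y) \<and> (\<forall>x y. \<rho> (x * y) = \<rho> x * \<rho> y) \<and> \<rho> 1 = 1}\<rparr>"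

definition order_Aut :: "('g::linordered_ab_group_add \<Rightarrow> 'g) monoid" where
  "order_Aut = (BijGroup UNIV)\<lparr>carrier :=
     {\<tau>. bij \<tau> \<and> (\<forall>g h. \<tau> (g + h) = \<tau> g + \<tau> h) \<and> strict_mono \<tau>}\<rparr>"

definition induces :: "('g::linordered_ab_group_add, 'k::field) series set \<Rightarrow>
    (('g, 'k) series \<Rightarrow> ('g, 'k) series) \<Rightarrow> ('g \<Rightarrow> 'g) \<Rightarrow> bool" where
  "induces K \<sigma> \<tau> \<longleftrightarrow> \<tau> \<in> carrier order_Aut \<and> (\<forall>a\<in>K - {\<zero>\<^bsub>hahn\<^esub>}. \<tau> (val a) = val (\<sigma> a))"

definition vAut :: "('g::linordered_ab_group_add, 'k::field) series set \<Rightarrow>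
    (('g, 'k) series \<Rightarrow> ('g, 'k) series) monoid" where
  "vAut K = (BijGroup K)\<lparr>carrier :=
     {\<sigma> \<in> Bij K. \<sigma> \<in> ring_hom (hahn\<lparr>carrier := K\<rparr>) (hahn\<lparr>carrier := K\<rparr>) \<and> (\<exists>\<tau>. induces K \<sigma> \<tau>)}\<rparr>"

definition Phi :: "('g::linordered_ab_group_add, 'k::field) series set \<Rightarrow>
    (('g, 'k) series \<Rightarrow> ('g, 'k) series) \<Rightarrow> ('k \<Rightarrow> 'k) \<times> ('g \<Rightarrow> 'g)" where
  "Phi K \<sigma> = (\<lambda>c. \<sigma> (t_mono 0 c) 0, THE \<tau>. induces K \<sigma> \<tau>)"

definition IntAut :: "('g::linordered_ab_group_add, 'k::field) series set \<Rightarrow>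
    (('g, 'k) series \<Rightarrow> ('g, 'k) series) monoid" where
  "IntAut K = (vAut K)\<lparr>carrier := kernel (vAut K) (field_Aut \<times>\<times> order_Aut) (Phi K)\<rparr>"

section \<open>Lifting properties\<close>

definition canonical_lift :: "('g::linordered_ab_group_add, 'k::field) series set \<Rightarrow>
    ('k \<Rightarrow> 'k) \<times> ('g \<Rightarrow> 'g) \<Rightarrow> ('g, 'k) series \<Rightarrow> ('g, 'k) series" where
  "canonical_lift K p = (\<lambda>a\<in>K. \<lambda>g. fst p (a (inv_into UNIV (snd p) g)))"

definition canonical_first_lifting :: "('g::linordered_ab_group_add, 'k::field) series set \<Rightarrow> bool" where
  "canonical_first_lifting K \<longleftrightarrow>
     (\<forall>p\<in>carrier (field_Aut \<times>\<times> order_Aut). canonical_lift K p ` K = K)"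

text \<open>\<open>first_lifting K \<Psi>\<close>: the field \<open>K\<close> has the first lifting property and \<open>\<Psi>\<close> is an admissible
  choice of the section of \<open>Phi K\<close>, the canonical one whenever that exists.\<close>

definition first_lifting :: "('g::linordered_ab_group_add, 'k::field) series set \<Rightarrow>
    (('k \<Rightarrow> 'k) \<times> ('g \<Rightarrow> 'g) \<Rightarrow> ('g, 'k) series \<Rightarrow> ('g, 'k) series) \<Rightarrow> bool" where
  "first_lifting K \<Psi> \<longleftrightarrow>
     \<Psi> \<in> hom (field_Aut \<times>\<times> order_Aut) (vAut K) \<and>
     inj_on \<Psi> (carrier (field_Aut \<times>\<times> order_Aut)) \<and>
     (\<forall>p\<in>carrier (field_Aut \<times>\<times> order_Aut). Phi K (\<Psi> p) = p) \<and>
     (canonical_first_lifting K \<longrightarrow>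
       (\<forall>p\<in>carrier (field_Aut \<times>\<times> order_Aut). \<Psi> p = canonical_lift K p))"

definition ExtAut :: "(('k::field \<Rightarrow> 'k) \<times> ('g::linordered_ab_group_add \<Rightarrow> 'g) \<Rightarrow>
    ('g, 'k) series \<Rightarrow> ('g, 'k) series) \<Rightarrow> (('g, 'k) series \<Rightarrow> ('g, 'k) series) set" where
  "ExtAut \<Psi> = \<Psi> ` carrier (field_Aut \<times>\<times> order_Aut)"

definition Hom_units :: "('g::linordered_ab_group_add \<Rightarrow> 'k::field) monoid" where
  "Hom_units = \<lparr>carrier = {x. (\<forall>g. x g \<noteq> 0) \<and> (\<forall>g h. x (g + h) = x g * x h)},
                monoid.mult = (\<lambda>x y g. x g * y g),
                monoid.one = (\<lambda>_. 1)\<rparr>"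

definition rho_map :: "('g::linordered_ab_group_add, 'k::field) series set \<Rightarrow> ('g \<Rightarrow> 'k) \<Rightarrow>
    ('g, 'k) series \<Rightarrow> ('g, 'k) series" where
  "rho_map K x = (\<lambda>a\<in>K. \<lambda>g. a g * x g)"

definition canonical_second_lifting :: "('g::linordered_ab_group_add, 'k::field) series set \<Rightarrow> bool" where
  "canonical_second_lifting K \<longleftrightarrow> rho_map K \<in> hom Hom_units (IntAut K)"

section \<open>Summability and strong additivity\<close>

definition summable_family :: "'i set \<Rightarrow> ('i \<Rightarrow> ('g::linordered_ab_group_add, 'k::field) series) \<Rightarrow> bool" where
  "summable_family I A \<longleftrightarrow>
     well_ordered (\<Union>i\<in>I. supp (A i)) \<and> (\<forall>g. finite {i\<in>I. g \<in> supp (A i)})"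

definition family_sum :: "'i set \<Rightarrow> ('i \<Rightarrow> ('g::linordered_ab_group_add, 'k::field) series) \<Rightarrow> ('g, 'k) series" where
  "family_sum I A = (\<lambda>g. \<Sum>i\<in>{i\<in>I. g \<in> supp (A i)}. A i g)"

definition K_summable :: "('g::linordered_ab_group_add, 'k::field) series set \<Rightarrow>
    'i set \<Rightarrow> ('i \<Rightarrow> ('g, 'k) series) \<Rightarrow> bool" where
  "K_summable K I A \<longleftrightarrow> summable_family I A \<and> (\<forall>i\<in>I. A i \<in> K) \<and> family_sum I A \<in> K"

definition K_summable_map :: "('g::linordered_ab_group_add, 'k::field) series set \<Rightarrow>
    (('g, 'k) series \<Rightarrow> ('g, 'k) series) \<Rightarrow> bool" where
  "K_summable_map K \<sigma> \<longleftrightarrow>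
     (\<forall>a\<in>K. K_summable K (supp a) (\<lambda>g. \<sigma> (t_mono g (a g))) \<and>
             \<sigma> a = family_sum (supp a) (\<lambda>g. \<sigma> (t_mono g (a g))))"

definition strongly_additive :: "('g::linordered_ab_group_add, 'k::field) series set \<Rightarrow>
    (('g, 'k) series \<Rightarrow> ('g, 'k) series) \<Rightarrow> bool" where
  "strongly_additive K \<sigma> \<longleftrightarrow>
     \<sigma> \<in> carrier (vAut K) \<and> K_summable_map K \<sigma> \<and> K_summable_map K (inv\<^bsub>vAut K\<^esub> \<sigma>)"

text \<open>\<open>v-Aut\<^sup>+\<close> of \<open>K\<close> with subscript \<open>(k)\<close> (constants preserved as a set), respectively
  with subscript \<open>k\<close> (constants fixed pointwise). For arbitrary \<open>K\<close> strong additivity is not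
  closed under composition, because a family \<open>\<sigma> (t_mono g (a g))\<close> may sum to an element of \<open>K\<close>
  only after cancellation; so these records need not be groups.\<close>

definition vAut_plus_stab :: "('g::linordered_ab_group_add, 'k::field) series set \<Rightarrow>
    (('g, 'k) series \<Rightarrow> ('g, 'k) series) monoid" where
  "vAut_plus_stab K = (vAut K)\<lparr>carrier :=
     {\<sigma> \<in> carrier (vAut K). \<sigma> ` constants = constants \<and> strongly_additive K \<sigma>}\<rparr>"

definition vAut_plus_fix :: "('g::linordered_ab_group_add, 'k::field) series set \<Rightarrow>
    (('g, 'k) series \<Rightarrow> ('g, 'k) series) monoid" where
  "vAut_plus_fix K = (vAut K)\<lparr>carrier :=
     {\<sigma> \<in> carrier (vAut K). (\<forall>c\<in>constants. \<sigma> c = c) \<and> strongly_additive K \<sigma>}\<rparr>"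

section \<open>Homomorphisms into the 1-units\<close>

definition tau_map :: "('g::linordered_ab_group_add, 'k::field) series set \<Rightarrow>
    ('g \<Rightarrow> ('g, 'k) series) \<Rightarrow> ('g, 'k) series \<Rightarrow> ('g, 'k) series" where
  "tau_map K u = (\<lambda>a\<in>K. family_sum (supp a) (\<lambda>g. t_mono g (a g) \<otimes>\<^bsub>hahn\<^esub> u g))"

text \<open>Being a group is not automatic for \<open>Hom_plus K\<close>: for \<open>K = k(t)\<close> it contains the \<open>u\<close> with
  \<open>u 1 = 1 + t\<close>, whose \<open>tau_map K u\<close> is the non-surjective substitution of \<open>t + t\<^sup>2\<close> for \<open>t\<close>.\<close>

definition Hom_plus :: "('g::linordered_ab_group_add, 'k::field) series set \<Rightarrow>
    ('g \<Rightarrow> ('g, 'k) series) monoid" where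
  "Hom_plus K = \<lparr>carrier = {u. (\<forall>g. u g \<in> one_units K) \<and>
                               (\<forall>g h. u (g + h) = u g \<otimes>\<^bsub>hahn\<^esub> u h) \<and>
                               (\<forall>a\<in>K. K_summable K (supp a) (\<lambda>g. t_mono g (a g) \<otimes>\<^bsub>hahn\<^esub> u g))},
                 monoid.mult = (\<lambda>u w g. tau_map K u (w g) \<otimes>\<^bsub>hahn\<^esub> u g),
                 monoid.one = (\<lambda>_. \<one>\<^bsub>hahn\<^esub>)\<rparr>"

section \<open>Semi-direct products\<close>

definition semidirect_action :: "('n, 'c) monoid_scheme \<Rightarrow> ('h, 'd) monoid_scheme \<Rightarrow>
    ('h \<Rightarrow> 'n \<Rightarrow> 'n) \<Rightarrow> bool" where
  "semidirect_action N H act \<longleftrightarrow> group N \<and> group H \<and>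
     (\<forall>h\<in>carrier H. act h \<in> iso N N) \<and>
     (\<forall>h\<in>carrier H. \<forall>h'\<in>carrier H. \<forall>n\<in>carrier N. act (h \<otimes>\<^bsub>H\<^esub> h') n = act h (act h' n))"

definition semidirect :: "('n, 'c) monoid_scheme \<Rightarrow> ('h, 'd) monoid_scheme \<Rightarrow>
    ('h \<Rightarrow> 'n \<Rightarrow> 'n) \<Rightarrow> ('n \<times> 'h) monoid" where
  "semidirect N H act =
     \<lparr>carrier = carrier N \<times> carrier H,
      monoid.mult = (\<lambda>(n, h) (n', h'). (n \<otimes>\<^bsub>N\<^esub> act h n', h \<otimes>\<^bsub>H\<^esub> h')),
      monoid.one = (\<one>\<^bsub>N\<^esub>, \<one>\<^bsub>H\<^esub>)\<rparr>"

definition conjugate :: "('a, 'b) monoid_scheme \<Rightarrow> 'a \<Rightarrow> 'a \<Rightarrow> 'a" where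
  "conjugate A s f = s \<otimes>\<^bsub>A\<^esub> f \<otimes>\<^bsub>A\<^esub> inv\<^bsub>A\<^esub> s"

text \<open>The actions are conjugation in \<open>vAut K\<close>, transported along the identifications of \<open>u\<close> with
  \<open>tau_map K u\<close>, of \<open>x\<close> with \<open>rho_map K x\<close>, of \<open>(u, x)\<close> with the composition of these two, and of
  \<open>p\<close> with \<open>\<Psi> p\<close>.\<close>

definition act_units :: "('g::linordered_ab_group_add, 'k::field) series set \<Rightarrow> ('g \<Rightarrow> 'k) \<Rightarrow>
    ('g \<Rightarrow> ('g, 'k) series) \<Rightarrow> ('g \<Rightarrow> ('g, 'k) series)" where
  "act_units K x u = the_inv_into (carrier (Hom_plus K)) (tau_map K)
     (conjugate (vAut K) (rho_map K x) (tau_map K u))"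

definition internal :: "('g::linordered_ab_group_add, 'k::field) series set \<Rightarrow>
    (('g \<Rightarrow> ('g, 'k) series) \<times> ('g \<Rightarrow> 'k)) monoid" where
  "internal K = semidirect (Hom_plus K) Hom_units (act_units K)"

definition internal_map :: "('g::linordered_ab_group_add, 'k::field) series set \<Rightarrow>
    ('g \<Rightarrow> ('g, 'k) series) \<times> ('g \<Rightarrow> 'k) \<Rightarrow> ('g, 'k) series \<Rightarrow> ('g, 'k) series" where
  "internal_map K = (\<lambda>(u, x). tau_map K u \<otimes>\<^bsub>vAut K\<^esub> rho_map K x)"

definition act_ext :: "('g::linordered_ab_group_add, 'k::field) series set \<Rightarrow>
    (('k \<Rightarrow> 'k) \<times> ('g \<Rightarrow> 'g) \<Rightarrow> ('g, 'k) series \<Rightarrow> ('g, 'k) series) \<Rightarrow>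
    ('k \<Rightarrow> 'k) \<times> ('g \<Rightarrow> 'g) \<Rightarrow>
    ('g \<Rightarrow> ('g, 'k) series) \<times> ('g \<Rightarrow> 'k) \<Rightarrow> ('g \<Rightarrow> ('g, 'k) series) \<times> ('g \<Rightarrow> 'k)" where
  "act_ext K \<Psi> p n = the_inv_into (carrier (internal K)) (internal_map K)
     (conjugate (vAut K) (\<Psi> p) (internal_map K n))"

definition act_ext_order :: "('g::linordered_ab_group_add, 'k::field) series set \<Rightarrow>
    (('k \<Rightarrow> 'k) \<times> ('g \<Rightarrow> 'g) \<Rightarrow> ('g, 'k) series \<Rightarrow> ('g, 'k) series) \<Rightarrow> ('g \<Rightarrow> 'g) \<Rightarrow>
    ('g \<Rightarrow> ('g, 'k) series) \<times> ('g \<Rightarrow> 'k) \<Rightarrow> ('g \<Rightarrow> ('g, 'k) series) \<times> ('g \<Rightarrow> 'k)" where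
  "act_ext_order K \<Psi> \<tau> = act_ext K \<Psi> (id, \<tau>)"

end

theory Submission
  imports Defs
begin

text \<open>
  The theorem unravels \<open>v-Aut\<^sup>+\<close> in two steps, each of which is a split extension of groups.

  On automorphisms that stabilise \<open>k\<close>, the homomorphism \<open>Phi\<close> records the induced automorphisms of
  \<open>k\<close> and of \<open>G\<close>. It is split by \<open>\<Psi>\<close>, whose values are strongly additive and stabilise \<open>k\<close>
  (\<open>\<Psi>_stab\<close>). So \<open>v-Aut\<^sup>+\<^sub>(\<^sub>k\<^sub>)\<close> is the semi-direct product of the kernel of \<open>Phi\<close>, called \<open>inner\<close> below,
  by \<open>Aut k \<times> o-Aut G\<close>. An element of \<open>inner\<close> fixes \<open>k\<close> pointwise; therefore \<open>v-Aut\<^sup>+\<^sub>k\<close> contains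
  the same kernel, with complement the image under \<open>\<Psi>\<close> of \<open>o-Aut G\<close>.

  An element \<open>\<sigma>\<close> of \<open>inner\<close> preserves values, so \<open>\<sigma> t\<^sup>g = x\<^sup>g t\<^sup>g + \<dots>\<close> with \<open>x\<^sup>g \<noteq> 0\<close>. Comparing
  leading terms, \<open>x\<close> is a character of \<open>G\<close>, and \<open>\<sigma> \<mapsto> x\<close> is a homomorphism to \<open>Hom(G, k\<^sup>\<times>)\<close>
  (\<open>leading_coeff_mult\<close>), split by \<open>x \<mapsto> \<rho>\<^sub>x\<close>. If \<open>x = 1\<close>, then \<open>u(g) = t\<^sup>-\<^sup>g \<sigma>(t\<^sup>g)\<close> is a
  homomorphism from \<open>G\<close> to the 1-units, and since a strongly additive automorphism is determined
  by its values on monomials, \<open>\<sigma> = \<tau>\<^sub>u\<close> (\<open>unit_leading_coeff_is_tau_map\<close>). Hence the kernel of \<open>\<sigma> \<mapsto> x\<close> is the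
  image of \<open>Hom\<^sup>+(G, 1 + I\<^sub>K)\<close> under the injection \<open>u \<mapsto> \<tau>\<^sub>u\<close>, and the operation on the latter
  corresponds to composition (\<open>tau_map_mult\<close>).

  The locale \<open>split_extension\<close> contains the group theory common to both steps. In it the action is
  by conjugation, transported along the embedding of the kernel, so its instances are the actions
  \<open>act_units\<close>, \<open>act_ext\<close> and \<open>act_ext_order\<close>. The computations with series reduce to shifts by
  monomials and to leading terms.
\<close>

section \<open>Split extensions\<close>

text \<open>An operation that an injection carries to the multiplication of a group inherits the group
  laws. This makes \<open>Hom_plus K\<close> a group: its laws are those of the composition of automorphisms.\<close>

lemma group_if_embedded:
  assumes "group A" and "subgroup (f ` carrier N) A" and "inj_on f (carrier N)"
    and one: "\<one>\<^bsub>N\<^esub> \<in> carrier N" "f \<one>\<^bsub>N\<^esub> = \<one>\<^bsub>A\<^esub>"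
    and closed: "\<And>m n. m \<in> carrier N \<Longrightarrow> n \<in> carrier N \<Longrightarrow> m \<otimes>\<^bsub>N\<^esub> n \<in> carrier N"
    and mult: "\<And>m n. m \<in> carrier N \<Longrightarrow> n \<in> carrier N \<Longrightarrow> f (m \<otimes>\<^bsub>N\<^esub> n) = f m \<otimes>\<^bsub>A\<^esub> f n"
  shows "group N"
proof -
  interpret A: group A by fact
  have fA: "f n \<in> carrier A" if "n \<in> carrier N" for n
    using that assms(2) subgroup.mem_carrier by fastforce
  show ?thesis
  proof (rule groupI)
    fix x y z assume x: "x \<in> carrier N" and y: "y \<in> carrier N" and z: "z \<in> carrier N"
    show "x \<otimes>\<^bsub>N\<^esub> y \<otimes>\<^bsub>N\<^esub> z = x \<otimes>\<^bsub>N\<^esub> (y \<otimes>\<^bsub>N\<^esub> z)"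
      by (rule inj_onD[OF assms(3)]) (simp_all add: x y z closed mult fA A.m_assoc)
  next
    fix x assume x: "x \<in> carrier N"
    show "\<one>\<^bsub>N\<^esub> \<otimes>\<^bsub>N\<^esub> x = x"
      by (rule inj_onD[OF assms(3)]) (simp_all add: x one closed mult fA)
    have "inv\<^bsub>A\<^esub> (f x) \<in> f ` carrier N"
      using assms(2) x by (simp add: subgroup.m_inv_closed)
    then obtain y where y: "y \<in> carrier N" "f y = inv\<^bsub>A\<^esub> (f x)" by auto
    have "y \<otimes>\<^bsub>N\<^esub> x = \<one>\<^bsub>N\<^esub>"
      by (rule inj_onD[OF assms(3)]) (simp_all add: x y one closed mult fA)
    with y show "\<exists>y\<in>carrier N. y \<otimes>\<^bsub>N\<^esub> x = \<one>\<^bsub>N\<^esub>" by blast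
  qed (use one closed in auto)
qed

text \<open>A split short exact sequence \<open>N \<rightarrow> S \<rightarrow> H\<close>, with \<open>S\<close> sitting inside a larger group \<open>A\<close>. The ambient
  \<open>A\<close> is kept because the inverses in the conjugation actions are taken in the full group of valuation preserving
  automorphisms, while the extension concerns a subgroup of it.\<close>

locale split_extension =
  fixes A :: "('a, 'x) monoid_scheme" and S :: "'a set"
    and N :: "('n, 'y) monoid_scheme" and H :: "('h, 'z) monoid_scheme"
    and f :: "'n \<Rightarrow> 'a" and \<pi> :: "'a \<Rightarrow> 'h" and \<psi> :: "'h \<Rightarrow> 'a"
  assumes A: "group A" and S: "subgroup S A" and N: "group N" and H: "group H"
    and f_hom: "f \<in> hom N A" and f_inj: "inj_on f (carrier N)"
    and f_image: "f ` carrier N = {s \<in> S. \<pi> s = \<one>\<^bsub>H\<^esub>}"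
    and \<pi>_hom: "\<pi> \<in> hom (A\<lparr>carrier := S\<rparr>) H"
    and \<psi>_hom: "\<psi> \<in> hom H A" and \<psi>_S: "\<And>h. h \<in> carrier H \<Longrightarrow> \<psi> h \<in> S"
    and \<pi>_\<psi>: "\<And>h. h \<in> carrier H \<Longrightarrow> \<pi> (\<psi> h) = h"
begin

sublocale A: group A by (rule A)
sublocale N: group N by (rule N)
sublocale H: group H by (rule H)

definition act :: "'h \<Rightarrow> 'n \<Rightarrow> 'n" where
  "act h n = the_inv_into (carrier N) f (conjugate A (\<psi> h) (f n))"

definition product_map :: "'n \<times> 'h \<Rightarrow> 'a" where
  "product_map = (\<lambda>(n, h). f n \<otimes>\<^bsub>A\<^esub> \<psi> h)"

lemma S_closed: "s \<in> S \<Longrightarrow> t \<in> S \<Longrightarrow> s \<otimes>\<^bsub>A\<^esub> t \<in> S" "s \<in> S \<Longrightarrow> inv\<^bsub>A\<^esub> s \<in> S" "s \<in> S \<Longrightarrow> s \<in> carrier A"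
  using S by (auto simp: subgroup.m_closed subgroup.m_inv_closed subgroup.mem_carrier)

lemma \<pi>_closed: "s \<in> S \<Longrightarrow> \<pi> s \<in> carrier H"
  using \<pi>_hom by (auto simp: hom_def)

lemma \<pi>_mult: "s \<in> S \<Longrightarrow> t \<in> S \<Longrightarrow> \<pi> (s \<otimes>\<^bsub>A\<^esub> t) = \<pi> s \<otimes>\<^bsub>H\<^esub> \<pi> t"
  using \<pi>_hom by (auto simp: hom_def)

lemma \<psi>_carrier: "h \<in> carrier H \<Longrightarrow> \<psi> h \<in> carrier A"
  using \<psi>_S S_closed by blast

lemma \<psi>_mult: "h \<in> carrier H \<Longrightarrow> h' \<in> carrier H \<Longrightarrow> \<psi> (h \<otimes>\<^bsub>H\<^esub> h') = \<psi> h \<otimes>\<^bsub>A\<^esub> \<psi> h'"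
  using \<psi>_hom by (auto simp: hom_def)

lemma f_mult: "m \<in> carrier N \<Longrightarrow> n \<in> carrier N \<Longrightarrow> f (m \<otimes>\<^bsub>N\<^esub> n) = f m \<otimes>\<^bsub>A\<^esub> f n"
  using f_hom by (auto simp: hom_def)

lemma f_S: "n \<in> carrier N \<Longrightarrow> f n \<in> S" and \<pi>_f: "n \<in> carrier N \<Longrightarrow> \<pi> (f n) = \<one>\<^bsub>H\<^esub>"
  using f_image by blast+

lemma f_carrier: "n \<in> carrier N \<Longrightarrow> f n \<in> carrier A"
  using f_S S_closed by blast

lemma \<psi>_one: "\<psi> \<one>\<^bsub>H\<^esub> = \<one>\<^bsub>A\<^esub>"
  using \<psi>_hom A H by (metis group.is_monoid hom_one)

lemma f_one: "f \<one>\<^bsub>N\<^esub> = \<one>\<^bsub>A\<^esub>"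
  using f_hom A N by (metis hom_one)

lemma \<pi>_one: "\<pi> \<one>\<^bsub>A\<^esub> = \<one>\<^bsub>H\<^esub>"
  using \<pi>_\<psi>[of "\<one>\<^bsub>H\<^esub>"] \<psi>_one by simp

lemma \<pi>_inv: assumes "s \<in> S" shows "\<pi> (inv\<^bsub>A\<^esub> s) = inv\<^bsub>H\<^esub> (\<pi> s)"
proof (rule H.inv_equality[symmetric])
  show "\<pi> (inv\<^bsub>A\<^esub> s) \<otimes>\<^bsub>H\<^esub> \<pi> s = \<one>\<^bsub>H\<^esub>"
    using \<pi>_mult[of "inv\<^bsub>A\<^esub> s" s] assms S_closed \<pi>_one by simp
qed (use assms S_closed \<pi>_closed in auto)

lemma conjugate_in_image:
  assumes "h \<in> carrier H" "n \<in> carrier N"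
  shows "conjugate A (\<psi> h) (f n) \<in> f ` carrier N"
  unfolding f_image conjugate_def
  using assms by (simp add: S_closed \<psi>_S f_S \<pi>_mult \<pi>_inv \<pi>_f \<pi>_\<psi>)

lemma f_act:
  "h \<in> carrier H \<Longrightarrow> n \<in> carrier N \<Longrightarrow> f (act h n) = \<psi> h \<otimes>\<^bsub>A\<^esub> f n \<otimes>\<^bsub>A\<^esub> inv\<^bsub>A\<^esub> (\<psi> h)"
  unfolding act_def using f_the_inv_into_f[OF f_inj conjugate_in_image] by (simp add: conjugate_def)

lemma act_closed: "h \<in> carrier H \<Longrightarrow> n \<in> carrier N \<Longrightarrow> act h n \<in> carrier N"
  unfolding act_def by (rule the_inv_into_into[OF f_inj conjugate_in_image order_refl])

lemma act_mult:
  assumes "h \<in> carrier H" "h' \<in> carrier H" "n \<in> carrier N"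
  shows "act (h \<otimes>\<^bsub>H\<^esub> h') n = act h (act h' n)"
  by (rule inj_onD[OF f_inj])
    (simp_all add: assms act_closed f_act \<psi>_mult A.m_assoc A.inv_mult_group \<psi>_carrier f_carrier)

lemma act_one: "n \<in> carrier N \<Longrightarrow> act \<one>\<^bsub>H\<^esub> n = n"
  by (rule inj_onD[OF f_inj]) (simp_all add: act_closed f_act \<psi>_one f_carrier)

lemma act_hom:
  assumes "h \<in> carrier H"
  shows "act h \<in> hom N N"
proof (rule homI)
  fix m n assume mn: "m \<in> carrier N" "n \<in> carrier N"
  show "act h (m \<otimes>\<^bsub>N\<^esub> n) = act h m \<otimes>\<^bsub>N\<^esub> act h n"
  proof (rule inj_onD[OF f_inj])
    show "f (act h (m \<otimes>\<^bsub>N\<^esub> n)) = f (act h m \<otimes>\<^bsub>N\<^esub> act h n)"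
      using assms mn
      by (simp add: act_closed f_act f_mult A.m_assoc \<psi>_carrier f_carrier A.inv_solve_left
          flip: A.m_assoc[of "inv\<^bsub>A\<^esub> (\<psi> h)"])
  qed (use assms mn in \<open>simp_all add: act_closed\<close>)
qed (use assms in \<open>simp add: act_closed\<close>)

lemma act_iso:
  assumes "h \<in> carrier H"
  shows "act h \<in> iso N N"
proof -
  have "bij_betw (act h) (carrier N) (carrier N)"
    by (rule bij_betw_byWitness[where f' = "act (inv\<^bsub>H\<^esub> h)"])
      (use assms in \<open>auto simp: act_closed act_one simp flip: act_mult\<close>)
  with act_hom[OF assms] show ?thesis by (simp add: iso_def)
qed

lemma semidirect_action_act: "semidirect_action N H act"
  unfolding semidirect_action_def by (simp add: N H act_iso act_mult)

text \<open>An element \<open>s\<close> of \<open>S\<close> factors uniquely because its \<open>H\<close>-component must be \<open>\<pi> s\<close>, and dividing by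
  \<open>\<psi> (\<pi> s)\<close> leaves an element of the kernel of \<open>\<pi>\<close>.\<close>

lemma product_map_bij:
  "bij_betw product_map (carrier N \<times> carrier H) S"
proof (rule bij_betwI')
  fix x y assume "x \<in> carrier N \<times> carrier H" "y \<in> carrier N \<times> carrier H"
  then obtain n h m k where xy: "x = (n, h)" "y = (m, k)"
    and nh: "n \<in> carrier N" "h \<in> carrier H" "m \<in> carrier N" "k \<in> carrier H" by auto
  have "n = m \<and> h = k" if eq: "f n \<otimes>\<^bsub>A\<^esub> \<psi> h = f m \<otimes>\<^bsub>A\<^esub> \<psi> k"
  proof -
    from eq have "\<pi> (f n \<otimes>\<^bsub>A\<^esub> \<psi> h) = \<pi> (f m \<otimes>\<^bsub>A\<^esub> \<psi> k)" by simp
    then have "h = k" using nh by (simp add: \<pi>_mult f_S \<psi>_S \<pi>_f \<pi>_\<psi>)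
    with eq have "f n = f m" using nh by (simp add: f_carrier \<psi>_carrier)
    with f_inj nh \<open>h = k\<close> show ?thesis by (auto dest: inj_onD)
  qed
  then show "(product_map x = product_map y) = (x = y)"
    by (auto simp: xy product_map_def)
next
  fix x assume "x \<in> carrier N \<times> carrier H"
  then show "product_map x \<in> S" by (auto simp: product_map_def f_S \<psi>_S S_closed)
next
  fix s assume s: "s \<in> S"
  define h where "h = \<pi> s"
  have h: "h \<in> carrier H" using s by (simp add: h_def \<pi>_closed)
  have "s \<otimes>\<^bsub>A\<^esub> inv\<^bsub>A\<^esub> (\<psi> h) \<in> f ` carrier N"
    unfolding f_image using s h by (simp add: S_closed \<psi>_S \<pi>_mult \<pi>_inv \<pi>_\<psi>) (simp add: h_def \<pi>_closed)
  then obtain n where "n \<in> carrier N" "f n = s \<otimes>\<^bsub>A\<^esub> inv\<^bsub>A\<^esub> (\<psi> h)" by auto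
  with s h show "\<exists>x\<in>carrier N \<times> carrier H. s = product_map x"
    by (intro bexI[of _ "(n, h)"]) (auto simp: product_map_def A.m_assoc \<psi>_carrier S_closed)
qed

lemma product_map_mult:
  assumes "x \<in> carrier (semidirect N H act)" "y \<in> carrier (semidirect N H act)"
  shows "product_map (x \<otimes>\<^bsub>semidirect N H act\<^esub> y) = product_map x \<otimes>\<^bsub>A\<^esub> product_map y"
  using assms
  by (auto simp: semidirect_def product_map_def f_mult act_closed f_act \<psi>_mult A.m_assoc
      \<psi>_carrier f_carrier A.inv_solve_left simp flip: A.m_assoc[of "inv\<^bsub>A\<^esub> (\<psi> _)"])

lemma product_map_image: "product_map ` carrier (semidirect N H act) = S"
  using product_map_bij by (simp add: semidirect_def bij_betw_def)

lemma product_map_inj: "inj_on product_map (carrier (semidirect N H act))"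
  using product_map_bij by (simp add: semidirect_def bij_betw_def)

lemma group_semidirect: "group (semidirect N H act)"
proof (rule group_if_embedded[OF A])
  show "subgroup (product_map ` carrier (semidirect N H act)) A"
    by (simp add: product_map_image S)
qed (auto simp: product_map_inj product_map_mult, auto simp: semidirect_def product_map_def
    f_one \<psi>_one act_closed)

lemma product_map_iso: "product_map \<in> iso (semidirect N H act) (A\<lparr>carrier := S\<rparr>)"
  using product_map_bij product_map_mult product_map_image
  by (auto simp: iso_def hom_def semidirect_def)

lemma iso_semidirect: "A\<lparr>carrier := S\<rparr> \<cong> semidirect N H act"
  using group.iso_sym[OF group_semidirect] product_map_iso by (auto simp: is_iso_def)

lemma product_map_hom: "product_map \<in> hom (semidirect N H act) A"
  using product_map_mult product_map_image S_closed(3) by (auto intro!: homI)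

end

section \<open>Monomials, leading terms and shifts\<close>

lemma hahn_simps:
  "carrier hahn = {a. well_ordered (supp a)}"
  "\<one>\<^bsub>hahn\<^esub> = t_mono 0 1"
  "\<zero>\<^bsub>hahn\<^esub> = (\<lambda>_. 0)"
  "a \<oplus>\<^bsub>hahn\<^esub> b = (\<lambda>g. a g + b g)"
  by (simp_all add: hahn_def)

lemma hahn_mult:
  "(a \<otimes>\<^bsub>hahn\<^esub> b) g = (\<Sum>h\<in>{h. a h \<noteq> 0 \<and> b (g - h) \<noteq> 0}. a h * b (g - h))"
  by (simp add: hahn_def)

text \<open>Products by a monomial and coefficients of leading terms are convolutions with at most one
  nonzero summand.\<close>

lemma hahn_mult_single:
  assumes "\<And>h. h \<noteq> x \<Longrightarrow> a h * b (g - h) = 0"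
  shows "(a \<otimes>\<^bsub>hahn\<^esub> b) g = a x * b (g - x)"
proof -
  have "(\<Sum>h\<in>{h. a h \<noteq> 0 \<and> b (g - h) \<noteq> 0}. a h * b (g - h)) = (\<Sum>h\<in>{x}. a h * b (g - h))"
    using assms by (intro sum.mono_neutral_left) auto
  then show ?thesis by (simp add: hahn_mult)
qed

lemma t_mono_mult: "t_mono g c \<otimes>\<^bsub>hahn\<^esub> a = (\<lambda>h. c * a (h - g))"
  by (rule ext, subst hahn_mult_single[where x = g]) (simp_all add: t_mono_def)

lemma mult_t_mono_0_1: "a \<otimes>\<^bsub>hahn\<^esub> t_mono 0 1 = a"
  by (rule ext, subst hahn_mult_single) (auto simp add: t_mono_def)

lemma t_mono_mult_t_mono: "t_mono g c \<otimes>\<^bsub>hahn\<^esub> t_mono h d = t_mono (g + h) (c * d)"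
  unfolding t_mono_mult by (auto simp: t_mono_def fun_eq_iff algebra_simps)

lemma supp_t_mono: "supp (t_mono g c) = (if c = 0 then {} else {g})"
  by (auto simp: supp_def t_mono_def)

lemma t_mono_apply [simp]: "t_mono g c g = c" "h \<noteq> g \<Longrightarrow> t_mono g c h = 0"
  by (auto simp: t_mono_def)

lemma t_mono_0 [simp]: "t_mono g 0 = (\<lambda>_. 0)"
  by (auto simp: t_mono_def)

lemma lead_mult:
  fixes a b :: "('g::linordered_ab_group_add, 'k::field) series"
  assumes "\<And>x. x < g \<Longrightarrow> a x = 0" "\<And>x. x < h \<Longrightarrow> b x = 0"
  shows "(a \<otimes>\<^bsub>hahn\<^esub> b) (g + h) = a g * b h"
proof -
  have "a x * b (g + h - x) = 0" if "x \<noteq> g" for x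
  proof (cases "x < g")
    case False
    with that have "g + h - x < h" by (simp add: algebra_simps)
    then show ?thesis using assms(2) by simp
  qed (use assms(1) in simp)
  then show ?thesis by (subst hahn_mult_single[where x = g]) auto
qed

text \<open>\<open>shift g a\<close> is \<open>t\<^sup>-\<^sup>g a\<close>. In coefficient form, moving powers of \<open>t\<close> through a product
  (\<open>shift_mult\<close>) is a reindexing of one sum.\<close>

definition shift :: "'g::ab_group_add \<Rightarrow> ('g, 'k) series \<Rightarrow> ('g, 'k) series" where
  "shift g a = (\<lambda>h. a (h + g))"

lemma shift_mult:
  fixes a b :: "('g::linordered_ab_group_add, 'k::field) series"
  shows "shift (g + h) (a \<otimes>\<^bsub>hahn\<^esub> b) = shift g a \<otimes>\<^bsub>hahn\<^esub> shift h b"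
proof
  fix x
  have "(\<Sum>y\<in>{y. a y \<noteq> 0 \<and> b (x + (g + h) - y) \<noteq> 0}. a y * b (x + (g + h) - y))
      = (\<Sum>y\<in>{y. a (y + g) \<noteq> 0 \<and> b (x - y + h) \<noteq> 0}. a (y + g) * b (x - y + h))"
    by (rule sum.reindex_bij_witness[where i = "\<lambda>y. y + g" and j = "\<lambda>y. y - g"])
      (auto simp: algebra_simps)
  then show "shift (g + h) (a \<otimes>\<^bsub>hahn\<^esub> b) x = (shift g a \<otimes>\<^bsub>hahn\<^esub> shift h b) x"
    by (simp add: shift_def hahn_mult)
qed

lemma t_mono_mult_shift: "t_mono g c \<otimes>\<^bsub>hahn\<^esub> shift g a = (\<lambda>h. c * a h)"
  by (simp add: t_mono_mult shift_def)

lemma t_mono_mult_cancel: "t_mono g 1 \<otimes>\<^bsub>hahn\<^esub> a = t_mono g 1 \<otimes>\<^bsub>hahn\<^esub> b \<Longrightarrow> a = b"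
proof
  fix h assume "t_mono g 1 \<otimes>\<^bsub>hahn\<^esub> a = t_mono g 1 \<otimes>\<^bsub>hahn\<^esub> b"
  then show "a h = b h" unfolding t_mono_mult by (auto dest: fun_cong[where x = "h + g"])
qed

lemma shift_eq_mult: "shift g a = t_mono (- g) 1 \<otimes>\<^bsub>hahn\<^esub> a"
  by (simp add: t_mono_mult shift_def)

lemma val_eqI:
  assumes "a g \<noteq> 0" "\<And>h. h < g \<Longrightarrow> a h = 0"
  shows "val a = g"
  unfolding val_def by (rule Least_equality) (use assms in \<open>auto simp: not_less[symmetric]\<close>)

lemma val_t_mono: "c \<noteq> 0 \<Longrightarrow> val (t_mono g c) = g"
  by (rule val_eqI) auto

lemma well_ordered_leading:
  fixes a :: "('g::linordered_ab_group_add, 'k::field) series"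
  assumes "well_ordered (supp a)" "a \<noteq> (\<lambda>_. 0)"
  shows "a (val a) \<noteq> 0" "h < val a \<Longrightarrow> a h = 0"
proof -
  have "supp a \<noteq> {}" using assms(2) by (auto simp: supp_def)
  then obtain m where "a m \<noteq> 0" "\<And>x. a x \<noteq> 0 \<Longrightarrow> m \<le> x"
    using assms(1) unfolding well_ordered_def supp_def by (metis (mono_tags, lifting) mem_Collect_eq order_refl)
  moreover from this have "val a = m" by (intro val_eqI) (auto simp: not_le[symmetric])
  ultimately show "a (val a) \<noteq> 0" "h < val a \<Longrightarrow> a h = 0" by (auto simp: not_le[symmetric])
qed

text \<open>A series with finite support is a fraction with denominator \<open>1\<close>.\<close>

lemma group_ring_subset_fractions:
  "(group_ring :: ('g::linordered_ab_group_add, 'k::field) series set) \<subseteq> group_ring_fractions"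
proof
  fix p :: "('g, 'k) series" assume p: "p \<in> group_ring"
  let ?one = "t_mono 0 1 :: ('g, 'k) series"
  have "inv\<^bsub>hahn\<^esub> ?one = ?one"
    unfolding m_inv_def
    by (rule the_equality)
      (auto simp: hahn_simps mult_t_mono_0_1 supp_t_mono well_ordered_def subset_singleton_iff)
  then have "p = p \<otimes>\<^bsub>hahn\<^esub> inv\<^bsub>hahn\<^esub> ?one" by (simp add: mult_t_mono_0_1)
  moreover have "?one \<in> group_ring" by (simp add: group_ring_def supp_t_mono)
  moreover have "?one \<noteq> \<zero>\<^bsub>hahn\<^esub>" by (auto simp: hahn_simps dest: fun_cong[where x = 0])
  ultimately show "p \<in> group_ring_fractions"
    unfolding group_ring_fractions_def using p by blast
qed

section \<open>Automorphism groups\<close>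

lemma BijGroup_UNIV_simps:
  "carrier (BijGroup UNIV) = {f. bij f}"
  "f \<in> Bij UNIV \<Longrightarrow> g \<in> Bij UNIV \<Longrightarrow> f \<otimes>\<^bsub>BijGroup UNIV\<^esub> g = f \<circ> g"
  "\<one>\<^bsub>BijGroup UNIV\<^esub> = id"
  by (auto simp: BijGroup_def Bij_def extensional_def compose_def)

lemma inv_BijGroup_UNIV: "bij f \<Longrightarrow> inv\<^bsub>BijGroup UNIV\<^esub> f = inv_into UNIV f"
  using inv_BijGroup[of f UNIV] by (auto simp: Bij_def extensional_def)

lemma field_Aut_carrier:
  "\<rho> \<in> carrier field_Aut \<longleftrightarrow>
     bij \<rho> \<and> (\<forall>x y. \<rho> (x + y) = \<rho> x + \<rho> y) \<and> (\<forall>x y. \<rho> (x * y) = \<rho> x * \<rho> y) \<and> \<rho> 1 = 1"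
  by (simp add: field_Aut_def)

lemma order_Aut_carrier:
  "\<tau> \<in> carrier order_Aut \<longleftrightarrow> bij \<tau> \<and> (\<forall>g h. \<tau> (g + h) = \<tau> g + \<tau> h) \<and> strict_mono \<tau>"
  by (simp add: order_Aut_def)

lemma field_Aut_mult:
  "\<rho> \<in> carrier field_Aut \<Longrightarrow> \<rho>' \<in> carrier field_Aut \<Longrightarrow> \<rho> \<otimes>\<^bsub>field_Aut\<^esub> \<rho>' = \<rho> \<circ> \<rho>'"
  and field_Aut_one [simp]: "\<one>\<^bsub>field_Aut\<^esub> = id"
  by (auto simp: field_Aut_def BijGroup_UNIV_simps Bij_def extensional_def)

lemma order_Aut_mult:
  "\<tau> \<in> carrier order_Aut \<Longrightarrow> \<tau>' \<in> carrier order_Aut \<Longrightarrow> \<tau> \<otimes>\<^bsub>order_Aut\<^esub> \<tau>' = \<tau> \<circ> \<tau>'"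
  and order_Aut_one [simp]: "\<one>\<^bsub>order_Aut\<^esub> = id"
  by (auto simp: order_Aut_def BijGroup_UNIV_simps Bij_def extensional_def)

lemma field_Aut_inv:
  assumes "\<rho> \<in> carrier field_Aut"
  shows "inv_into UNIV \<rho> \<in> carrier field_Aut"
proof -
  have r: "bij \<rho>" "\<And>x y. \<rho> (x + y) = \<rho> x + \<rho> y" "\<And>x y. \<rho> (x * y) = \<rho> x * \<rho> y" "\<rho> 1 = 1"
    using assms by (auto simp: field_Aut_carrier)
  note i = bij_is_inj[OF r(1)] surj_f_inv_f[OF bij_is_surj[OF r(1)]]
  show ?thesis
    unfolding field_Aut_carrier
    by (auto simp: r i bij_imp_bij_inv inv_f_eq[OF i(1)])
qed

lemma order_Aut_inv:
  assumes "\<tau> \<in> carrier order_Aut"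
  shows "inv_into UNIV \<tau> \<in> carrier order_Aut"
proof -
  have r: "bij \<tau>" "\<And>x y. \<tau> (x + y) = \<tau> x + \<tau> y" "strict_mono \<tau>"
    using assms by (auto simp: order_Aut_carrier)
  note i = bij_is_inj[OF r(1)] surj_f_inv_f[OF bij_is_surj[OF r(1)]]
  have "inv_into UNIV \<tau> x < inv_into UNIV \<tau> y" if "x < y" for x y
    using that strict_mono_less[OF r(3), of "inv_into UNIV \<tau> x" "inv_into UNIV \<tau> y"] by (simp add: i)
  then show ?thesis
    unfolding order_Aut_carrier strict_mono_def
    by (auto simp: r i bij_imp_bij_inv inv_f_eq[OF i(1)])
qed

lemma group_field_Aut: "group (field_Aut :: ('k::field \<Rightarrow> 'k) monoid)"
proof -
  interpret B: group "BijGroup (UNIV :: 'k set)" by (rule group_BijGroup)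
  have "subgroup (carrier field_Aut) (BijGroup (UNIV :: 'k set))"
  proof (rule B.subgroupI)
    show "carrier (field_Aut :: ('k \<Rightarrow> 'k) monoid) \<noteq> {}"
      using field_Aut_carrier[of id] by auto
  next
    fix \<rho> :: "'k \<Rightarrow> 'k" assume "\<rho> \<in> carrier field_Aut"
    then show "inv\<^bsub>BijGroup UNIV\<^esub> \<rho> \<in> carrier field_Aut"
      using field_Aut_inv[of \<rho>] by (simp add: inv_BijGroup_UNIV field_Aut_carrier)
  qed (auto simp: field_Aut_carrier BijGroup_UNIV_simps Bij_def extensional_def bij_comp)
  then show ?thesis
    using subgroup.subgroup_is_group[OF _ group_BijGroup] by (fastforce simp: field_Aut_def)
qed

lemma group_order_Aut: "group (order_Aut :: ('g::linordered_ab_group_add \<Rightarrow> 'g) monoid)"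
proof -
  interpret B: group "BijGroup (UNIV :: 'g set)" by (rule group_BijGroup)
  have "subgroup (carrier order_Aut) (BijGroup (UNIV :: 'g set))"
  proof (rule B.subgroupI)
    show "carrier (order_Aut :: ('g \<Rightarrow> 'g) monoid) \<noteq> {}"
      using order_Aut_carrier[of id] by (auto simp: strict_mono_def)
  next
    fix \<tau> :: "'g \<Rightarrow> 'g" assume "\<tau> \<in> carrier order_Aut"
    then show "inv\<^bsub>BijGroup UNIV\<^esub> \<tau> \<in> carrier order_Aut"
      using order_Aut_inv[of \<tau>] by (simp add: inv_BijGroup_UNIV order_Aut_carrier)
  qed (auto simp: order_Aut_carrier BijGroup_UNIV_simps Bij_def extensional_def bij_comp strict_mono_def)
  then show ?thesis
    using subgroup.subgroup_is_group[OF _ group_BijGroup] by (fastforce simp: order_Aut_def)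
qed

lemma group_Hom_units: "group (Hom_units :: ('g::linordered_ab_group_add \<Rightarrow> 'k::field) monoid)"
proof (rule groupI)
  fix x :: "'g \<Rightarrow> 'k" assume "x \<in> carrier Hom_units"
  then show "\<exists>y\<in>carrier Hom_units. y \<otimes>\<^bsub>Hom_units\<^esub> x = \<one>\<^bsub>Hom_units\<^esub>"
    by (intro bexI[of _ "\<lambda>g. inverse (x g)"]) (auto simp: Hom_units_def)
qed (auto simp: Hom_units_def mult_ac)

lemma Hom_units_zero: "x \<in> carrier Hom_units \<Longrightarrow> x 0 = 1"
proof -
  assume x: "x \<in> carrier Hom_units"
  have "x 0 \<noteq> 0" "x (0 + 0) = x 0 * x 0"
    using x unfolding Hom_units_def by (simp, simp only: partial_object.simps mem_Collect_eq)
  then show ?thesis by simp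
qed

section \<open>Valuation preserving automorphisms\<close>

lemma family_sum_empty_or_singleton:
  "family_sum {} A = (\<lambda>_. 0)" "family_sum {i} A = A i"
proof -
  show "family_sum {} A = (\<lambda>_. 0)" by (simp add: family_sum_def)
  have "{j \<in> {i}. g \<in> supp (A j)} = (if A i g = 0 then {} else {i})" for g
    by (auto simp: supp_def)
  then show "family_sum {i} A = A i" by (simp add: family_sum_def fun_eq_iff)
qed

text \<open>The canonical lifts stabilise the constants, which places them in the group with subscript \<open>(k)\<close>.\<close>

lemma canonical_lift_t_mono_zero:
  assumes "p \<in> carrier (field_Aut \<times>\<times> order_Aut)" "t_mono 0 c \<in> K"
  shows "canonical_lift K p (t_mono 0 c) = t_mono 0 (fst p c)"
proof
  fix g
  obtain \<rho> \<tau> where p: "p = (\<rho>, \<tau>)" "\<rho> \<in> carrier field_Aut" "\<tau> \<in> carrier order_Aut"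
    using assms(1) by auto
  then have "\<rho> (0 + 0) = \<rho> 0 + \<rho> 0" "\<tau> (0 + 0) = \<tau> 0 + \<tau> 0" "bij \<tau>"
    unfolding field_Aut_carrier order_Aut_carrier by (blast, blast, blast)
  then have "\<rho> 0 = 0" "\<tau> 0 = 0" by (simp_all only: add_0_right add_cancel_right_right)
  moreover have "inv_into UNIV \<tau> g = 0 \<longleftrightarrow> g = 0"
    using bij_inv_eq_iff[OF \<open>bij \<tau>\<close>, of 0 g] \<open>\<tau> 0 = 0\<close> by metis
  ultimately show "canonical_lift K p (t_mono 0 c) g = t_mono 0 (fst p c) g"
    using assms(2) by (simp add: canonical_lift_def p t_mono_def)
qed

locale hahn_subfield =
  fixes K :: "('g::linordered_ab_group_add, 'k::field) series set"
  assumes K: "hahn_field K"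
begin

lemma subring_K: "subring K hahn"
  using K by (simp add: hahn_field_def subfield_def subdomain_def subcring_def)

lemma K_add: "a \<in> K \<Longrightarrow> b \<in> K \<Longrightarrow> (\<lambda>g. a g + b g) \<in> K"
  using subringE(7)[OF subring_K] by (simp add: hahn_simps)

lemma K_mult: "a \<in> K \<Longrightarrow> b \<in> K \<Longrightarrow> a \<otimes>\<^bsub>hahn\<^esub> b \<in> K"
  using subringE(6)[OF subring_K] by simp

lemma K_well_ordered: "a \<in> K \<Longrightarrow> well_ordered (supp a)"
  using subringE(1)[OF subring_K] by (auto simp: hahn_simps)

lemma t_mono_K: "t_mono g c \<in> K"
proof -
  have "t_mono g c \<in> group_ring" by (simp add: group_ring_def supp_t_mono)
  then show ?thesis using K group_ring_subset_fractions by (auto simp: hahn_field_def)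
qed

lemma zero_K: "(\<lambda>_. 0) \<in> K"
  using t_mono_K[of 0 0] by simp

lemma shift_K: "a \<in> K \<Longrightarrow> shift g a \<in> K"
  by (simp add: shift_eq_mult K_mult t_mono_K)

lemma val_nonzero: "a \<in> K \<Longrightarrow> a \<noteq> (\<lambda>_. 0) \<Longrightarrow> a (val a) \<noteq> 0"
  using well_ordered_leading(1) K_well_ordered by blast

lemma below_val: "a \<in> K \<Longrightarrow> a \<noteq> (\<lambda>_. 0) \<Longrightarrow> h < val a \<Longrightarrow> a h = 0"
  using well_ordered_leading(2) K_well_ordered by blast

text \<open>The coefficient form of \<open>v(a - 1) > 0\<close>; it includes the value \<open>\<infinity>\<close> at \<open>a = 1\<close>.\<close>

lemma one_units_iff: "a \<in> one_units K \<longleftrightarrow> a \<in> K \<and> a 0 = 1 \<and> (\<forall>h<0. a h = 0)"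
proof
  assume "a \<in> one_units K"
  then obtain b where b: "a = (\<lambda>g. t_mono 0 1 g + b g)" "b \<in> K" "b = (\<lambda>_. 0) \<or> 0 < val b"
    unfolding one_units_def pos_val_def hahn_simps mem_Collect_eq
    by (elim exE conjE, intro that)
  then have "b h = 0" if "h \<le> 0" for h
    using below_val[of b h] that by (metis le_less_trans)
  with b show "a \<in> K \<and> a 0 = 1 \<and> (\<forall>h<0. a h = 0)"
    by (auto simp: t_mono_K K_add)
next
  assume a: "a \<in> K \<and> a 0 = 1 \<and> (\<forall>h<0. a h = 0)"
  define b where "b = (\<lambda>g. a g + t_mono 0 (- 1) g)"
  have b: "b \<in> K" using a by (simp add: b_def K_add t_mono_K)
  have "b h = 0" if "h \<le> 0" for h
    using a that by (cases "h = 0") (auto simp: b_def)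
  then have "b = (\<lambda>_. 0) \<or> 0 < val b"
    using val_nonzero[OF b] by (metis not_le)
  moreover have "a = (\<lambda>g. t_mono 0 1 g + b g)" by (auto simp: b_def t_mono_def)
  ultimately show "a \<in> one_units K"
    using b by (auto simp: one_units_def pos_val_def hahn_simps)
qed

lemma vAut_iff:
  "\<sigma> \<in> carrier (vAut K) \<longleftrightarrow> \<sigma> \<in> Bij K \<and>
     \<sigma> \<in> ring_hom (hahn\<lparr>carrier := K\<rparr>) (hahn\<lparr>carrier := K\<rparr>) \<and> (\<exists>\<tau>. induces K \<sigma> \<tau>)"
  by (simp add: vAut_def)

lemma ring_hom_K_iff:
  "\<sigma> \<in> ring_hom (hahn\<lparr>carrier := K\<rparr>) (hahn\<lparr>carrier := K\<rparr>) \<longleftrightarrow>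
     (\<forall>a\<in>K. \<sigma> a \<in> K) \<and> (\<forall>a\<in>K. \<forall>b\<in>K. \<sigma> (a \<otimes>\<^bsub>hahn\<^esub> b) = \<sigma> a \<otimes>\<^bsub>hahn\<^esub> \<sigma> b) \<and>
     (\<forall>a\<in>K. \<forall>b\<in>K. \<sigma> (\<lambda>g. a g + b g) = (\<lambda>g. \<sigma> a g + \<sigma> b g)) \<and> \<sigma> (t_mono 0 1) = t_mono 0 1"
  by (auto simp: ring_hom_def hahn_simps)

lemma
  assumes "\<sigma> \<in> carrier (vAut K)"
  shows vAut_Bij: "\<sigma> \<in> Bij K"
    and vAut_bij: "bij_betw \<sigma> K K"
    and vAut_extensional: "\<sigma> \<in> extensional K"
    and vAut_closed: "a \<in> K \<Longrightarrow> \<sigma> a \<in> K"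
    and vAut_mult: "a \<in> K \<Longrightarrow> b \<in> K \<Longrightarrow> \<sigma> (a \<otimes>\<^bsub>hahn\<^esub> b) = \<sigma> a \<otimes>\<^bsub>hahn\<^esub> \<sigma> b"
    and vAut_add: "a \<in> K \<Longrightarrow> b \<in> K \<Longrightarrow> \<sigma> (\<lambda>g. a g + b g) = (\<lambda>g. \<sigma> a g + \<sigma> b g)"
    and vAut_one: "\<sigma> (t_mono 0 1) = t_mono 0 1"
  using assms by (auto simp: vAut_iff ring_hom_K_iff Bij_def)

lemma vAut_zero:
  assumes "\<sigma> \<in> carrier (vAut K)"
  shows "\<sigma> (\<lambda>_. 0) = (\<lambda>_. 0)"
proof
  fix g
  show "\<sigma> (\<lambda>_. 0) g = 0"
    using fun_cong[OF vAut_add[OF assms zero_K zero_K], of g] by (simp only: add_0_right add_cancel_right_right)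
qed

lemma vAut_nonzero:
  assumes "\<sigma> \<in> carrier (vAut K)" "a \<in> K" "a \<noteq> (\<lambda>_. 0)"
  shows "\<sigma> a \<noteq> (\<lambda>_. 0)"
  using vAut_zero[OF assms(1)] vAut_bij[OF assms(1)] assms(2,3) zero_K
  by (metis bij_betw_imp_inj_on inj_onD)

lemma induces_val:
  assumes "induces K \<sigma> \<tau>" "a \<in> K" "a \<noteq> (\<lambda>_. 0)"
  shows "val (\<sigma> a) = \<tau> (val a)"
  using assms by (auto simp: induces_def hahn_simps)

text \<open>The induced automorphism of \<open>G\<close> is determined by the values of the images of the monomials, so the
  definite description in \<open>Phi\<close> denotes it.\<close>

lemma induces_unique:
  assumes "induces K \<sigma> \<tau>"
  shows "\<tau> g = val (\<sigma> (t_mono g 1))"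
proof -
  have "t_mono g (1::'k) \<noteq> (\<lambda>_. 0)" by (auto dest: fun_cong[where x = g])
  then show ?thesis using induces_val[OF assms t_mono_K, of g 1] by (simp add: val_t_mono)
qed

lemma snd_Phi: "induces K \<sigma> \<tau> \<Longrightarrow> snd (Phi K \<sigma>) = \<tau>"
  unfolding Phi_def snd_conv by (rule the_equality) (auto simp: induces_unique)

lemma vAut_induces: "\<sigma> \<in> carrier (vAut K) \<Longrightarrow> induces K \<sigma> (snd (Phi K \<sigma>))"
  unfolding vAut_iff using snd_Phi by blast

lemma vAut_mult_eq:
  "\<sigma> \<in> carrier (vAut K) \<Longrightarrow> \<sigma>' \<in> carrier (vAut K) \<Longrightarrow> \<sigma> \<otimes>\<^bsub>vAut K\<^esub> \<sigma>' = compose K \<sigma> \<sigma>'"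
  by (simp add: vAut_def BijGroup_def)

lemma vAut_mult_apply:
  "\<sigma> \<in> carrier (vAut K) \<Longrightarrow> \<sigma>' \<in> carrier (vAut K) \<Longrightarrow> a \<in> K \<Longrightarrow> (\<sigma> \<otimes>\<^bsub>vAut K\<^esub> \<sigma>') a = \<sigma> (\<sigma>' a)"
  by (simp add: vAut_mult_eq compose_def)

lemma vAut_one_eq: "\<one>\<^bsub>vAut K\<^esub> = (\<lambda>a\<in>K. a)"
  by (simp add: vAut_def BijGroup_def)

lemma induces_compose:
  assumes \<sigma>: "induces K \<sigma> \<tau>" and \<sigma>': "\<sigma>' \<in> carrier (vAut K)" "induces K \<sigma>' \<tau>'"
  shows "induces K (compose K \<sigma> \<sigma>') (\<tau> \<circ> \<tau>')"
proof -
  have "\<tau> \<circ> \<tau>' \<in> carrier order_Aut"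
    using assms group.is_monoid[OF group_order_Aut, THEN monoid.m_closed]
    by (metis induces_def order_Aut_mult)
  moreover have "val (\<sigma> (\<sigma>' a)) = \<tau> (\<tau>' (val a))" if "a \<in> K" "a \<noteq> (\<lambda>_. 0)" for a
    using that assms by (simp add: induces_val vAut_closed vAut_nonzero)
  ultimately show ?thesis by (auto simp: induces_def hahn_simps compose_def)
qed

lemma compose_vAut:
  assumes "\<sigma> \<in> carrier (vAut K)" "\<sigma>' \<in> carrier (vAut K)"
  shows "compose K \<sigma> \<sigma>' \<in> carrier (vAut K)"
  unfolding vAut_iff
proof (intro conjI)
  show "compose K \<sigma> \<sigma>' \<in> Bij K" using assms by (simp add: compose_Bij vAut_Bij)
  show "compose K \<sigma> \<sigma>' \<in> ring_hom (hahn\<lparr>carrier := K\<rparr>) (hahn\<lparr>carrier := K\<rparr>)"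
    unfolding ring_hom_K_iff
    by (auto simp: compose_def K_mult K_add t_mono_K vAut_closed[OF assms(1)] vAut_closed[OF assms(2)]
        vAut_mult[OF assms(1)] vAut_mult[OF assms(2)] vAut_add[OF assms(1)] vAut_add[OF assms(2)]
        vAut_one[OF assms(1)] vAut_one[OF assms(2)])
  show "\<exists>\<tau>. induces K (compose K \<sigma> \<sigma>') \<tau>"
    using induces_compose vAut_induces assms by blast
qed

lemma inverse_vAut:
  assumes \<sigma>: "\<sigma> \<in> carrier (vAut K)"
  shows "(\<lambda>a\<in>K. inv_into K \<sigma> a) \<in> carrier (vAut K)" (is "?i \<in> _")
proof -
  note inj = bij_betw_imp_inj_on[OF vAut_bij[OF \<sigma>]]
  have im: "\<sigma> ` K = K" using vAut_bij[OF \<sigma>] by (simp add: bij_betw_def)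
  have i: "?i a \<in> K" "\<sigma> (?i a) = a" if "a \<in> K" for a
    using that im by (auto simp: f_inv_into_f inv_into_into)
  have eqI: "?i a = b" if "a = \<sigma> b" "b \<in> K" for a b
    using that inj \<sigma> by (simp add: vAut_closed)
  have "?i \<in> ring_hom (hahn\<lparr>carrier := K\<rparr>) (hahn\<lparr>carrier := K\<rparr>)"
    unfolding ring_hom_K_iff
    by (intro conjI ballI eqI)
      (simp_all only: i K_mult K_add t_mono_K vAut_mult[OF \<sigma>] vAut_add[OF \<sigma>] vAut_one[OF \<sigma>])
  moreover have "induces K ?i (inv_into UNIV (snd (Phi K \<sigma>)))"
  proof -
    let ?\<tau> = "snd (Phi K \<sigma>)"
    have \<tau>: "induces K \<sigma> ?\<tau>" by (rule vAut_induces[OF \<sigma>])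
    then have "?\<tau> \<in> carrier order_Aut" by (simp add: induces_def)
    then have bij: "bij ?\<tau>" by (simp add: order_Aut_carrier)
    have "inv_into UNIV ?\<tau> (val a) = val (?i a)" if a: "a \<in> K" "a \<noteq> (\<lambda>_. 0)" for a
    proof -
      have "?i a \<noteq> (\<lambda>_. 0)" using i(2)[OF a(1)] a(2) vAut_zero[OF \<sigma>] by auto
      then have "val (\<sigma> (?i a)) = ?\<tau> (val (?i a))" using induces_val[OF \<tau> i(1)[OF a(1)]] by simp
      then show ?thesis unfolding i(2)[OF a(1)] by (simp only: inv_f_f[OF bij_is_inj[OF bij]])
    qed
    then show ?thesis
      unfolding induces_def hahn_simps using order_Aut_inv[OF \<open>?\<tau> \<in> _\<close>] by blast
  qed
  ultimately show ?thesis
    unfolding vAut_iff using restrict_inv_into_Bij[OF vAut_Bij[OF \<sigma>]] by blast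
qed

lemma group_vAut: "group (vAut K)"
proof -
  interpret B: group "BijGroup K" by (rule group_BijGroup)
  have sub: "carrier (vAut K) \<subseteq> Bij K" by (auto simp: vAut_iff)
  have "(\<lambda>a\<in>K. a) \<in> carrier (vAut K)"
    unfolding vAut_iff
  proof (intro conjI exI)
    show "induces K (\<lambda>a\<in>K. a) id"
      by (auto simp: induces_def order_Aut_carrier strict_mono_def)
  qed (auto simp: id_Bij ring_hom_K_iff K_mult K_add t_mono_K)
  then have "subgroup (carrier (vAut K)) (BijGroup K)"
  proof (intro B.subgroupI)
    show "\<sigma> \<otimes>\<^bsub>BijGroup K\<^esub> \<sigma>' \<in> carrier (vAut K)"
      if "\<sigma> \<in> carrier (vAut K)" "\<sigma>' \<in> carrier (vAut K)" for \<sigma> \<sigma>'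
      using that sub compose_vAut by (auto simp: BijGroup_def)
    show "inv\<^bsub>BijGroup K\<^esub> \<sigma> \<in> carrier (vAut K)" if "\<sigma> \<in> carrier (vAut K)" for \<sigma>
      using that sub inverse_vAut by (auto simp: inv_BijGroup)
  qed (use sub in \<open>auto simp: BijGroup_def\<close>)
  then show ?thesis
    using subgroup.subgroup_is_group[OF _ group_BijGroup] by (fastforce simp: vAut_def)
qed

sublocale vAut: group "vAut K" by (rule group_vAut)

lemma snd_Phi_mult:
  assumes "\<sigma> \<in> carrier (vAut K)" "\<sigma>' \<in> carrier (vAut K)"
  shows "snd (Phi K (\<sigma> \<otimes>\<^bsub>vAut K\<^esub> \<sigma>')) = snd (Phi K \<sigma>) \<circ> snd (Phi K \<sigma>')"
  using assms by (simp add: vAut_mult_eq snd_Phi induces_compose vAut_induces)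

section \<open>Automorphisms that preserve leading exponents\<close>

text \<open>If \<open>\<sigma>\<close> induces the identity on \<open>G\<close>, it preserves values, hence all the sets
  \<open>{a. v a \<ge> g}\<close> and \<open>{a. v a > g}\<close>.\<close>

lemma below_image:
  assumes \<sigma>: "\<sigma> \<in> carrier (vAut K)" "snd (Phi K \<sigma>) = id" and a: "a \<in> K"
  shows "(\<And>h. h < g \<Longrightarrow> a h = 0) \<Longrightarrow> h < g \<Longrightarrow> \<sigma> a h = 0"
    and "(\<And>h. h \<le> g \<Longrightarrow> a h = 0) \<Longrightarrow> h \<le> g \<Longrightarrow> \<sigma> a h = 0"
proof -
  have *: "\<sigma> a h = 0" if "a = (\<lambda>_. 0) \<or> h < val a" for h
  proof (cases "a = (\<lambda>_. 0)")
    case False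
    then have "val (\<sigma> a) = val a" using induces_val[OF vAut_induces[OF \<sigma>(1)] a] \<sigma>(2) by simp
    then show ?thesis
      using that False below_val[OF vAut_closed[OF \<sigma>(1) a]] vAut_nonzero[OF \<sigma>(1) a] by auto
  qed (simp add: vAut_zero \<sigma>)
  {
    assume "\<And>h. h < g \<Longrightarrow> a h = 0" and h: "h < g"
    then have "a = (\<lambda>_. 0) \<or> g \<le> val a" using val_nonzero[OF a] by (metis not_le)
    then show "\<sigma> a h = 0" using h by (intro *) auto
  next
    assume "\<And>h. h \<le> g \<Longrightarrow> a h = 0" and h: "h \<le> g"
    then have "a = (\<lambda>_. 0) \<or> g < val a" using val_nonzero[OF a] by (metis not_le)
    then show "\<sigma> a h = 0" using h by (intro *) auto
  }
qed

lemma vAut_t_mono: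
  assumes "\<sigma> \<in> carrier (vAut K)" "\<And>c. \<sigma> (t_mono 0 c) = t_mono 0 c"
  shows "\<sigma> (t_mono g c) = (\<lambda>h. c * \<sigma> (t_mono g 1) h)"
proof -
  have "\<sigma> (t_mono g c) = \<sigma> (t_mono 0 c \<otimes>\<^bsub>hahn\<^esub> t_mono g 1)" by (simp add: t_mono_mult_t_mono)
  also have "\<dots> = t_mono 0 c \<otimes>\<^bsub>hahn\<^esub> \<sigma> (t_mono g 1)" by (simp add: vAut_mult t_mono_K assms)
  finally show ?thesis by (simp add: t_mono_mult)
qed

text \<open>For an automorphism trivial on the value group this function of \<open>g\<close> is the character \<open>x\<close> of \<open>G\<close> with
  \<open>\<sigma> t\<^sup>g = x\<^sup>g t\<^sup>g + \<dots>\<close>.\<close>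

definition leading_coeff :: "(('g, 'k) series \<Rightarrow> ('g, 'k) series) \<Rightarrow> 'g \<Rightarrow> 'k" where
  "leading_coeff \<sigma> = (\<lambda>g. \<sigma> (t_mono g 1) g)"

text \<open>Modulo series of value greater than \<open>g\<close>, the series \<open>a\<close> is the monomial \<open>a\<^sub>g t\<^sup>g\<close>, and \<open>\<sigma>\<close> respects
  this congruence. Since constants are fixed, the leading coefficient of \<open>\<sigma> a\<close> can be read off
  from \<open>\<sigma> t\<^sup>g\<close>; this is what turns \<open>leading_coeff\<close> into a homomorphism.\<close>

lemma leading_image:
  assumes \<sigma>: "\<sigma> \<in> carrier (vAut K)" "snd (Phi K \<sigma>) = id" "\<And>c. \<sigma> (t_mono 0 c) = t_mono 0 c"
    and a: "a \<in> K" "\<And>h. h < g \<Longrightarrow> a h = 0"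
  shows "\<sigma> a g = a g * leading_coeff \<sigma> g"
proof -
  define b where "b = (\<lambda>h. a h + t_mono g (- a g) h)"
  have b: "b \<in> K" by (simp add: b_def K_add a t_mono_K)
  have "b h = 0" if "h \<le> g" for h
    using a(2)[of h] that by (cases "h = g") (auto simp: b_def)
  then have "\<sigma> b g = 0" using below_image(2)[OF \<sigma>(1,2) b, of g g] by simp
  moreover have "\<sigma> a = \<sigma> (\<lambda>h. b h + t_mono g (a g) h)"
    by (rule arg_cong[where f = \<sigma>]) (auto simp: b_def t_mono_def)
  ultimately show ?thesis
    by (simp add: vAut_add[OF \<sigma>(1) b] t_mono_K leading_coeff_def vAut_t_mono[OF \<sigma>(1,3), of g "a g"])
qed

lemma leading_coeff_Hom_units:
  assumes \<sigma>: "\<sigma> \<in> carrier (vAut K)" "snd (Phi K \<sigma>) = id"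
  shows "leading_coeff \<sigma> \<in> carrier Hom_units"
proof -
  have "leading_coeff \<sigma> g \<noteq> 0" for g
  proof -
    have t: "t_mono g (1::'k) \<noteq> (\<lambda>_. 0)" by (auto dest: fun_cong[where x = g])
    have "val (\<sigma> (t_mono g 1)) = g"
      using induces_unique[OF vAut_induces[OF \<sigma>(1)], of g] \<sigma>(2) by simp
    then show ?thesis
      using val_nonzero[OF vAut_closed[OF \<sigma>(1) t_mono_K] vAut_nonzero[OF \<sigma>(1) t_mono_K t]]
      by (simp add: leading_coeff_def)
  qed
  moreover have "leading_coeff \<sigma> (g + h) = leading_coeff \<sigma> g * leading_coeff \<sigma> h" for g h
  proof -
    have "\<sigma> (t_mono (g + h) 1) = \<sigma> (t_mono g 1) \<otimes>\<^bsub>hahn\<^esub> \<sigma> (t_mono h 1)"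
      using vAut_mult[OF \<sigma>(1) t_mono_K t_mono_K, of g 1 h 1] by (simp add: t_mono_mult_t_mono)
    then show ?thesis
      unfolding leading_coeff_def
      by (simp only:, intro lead_mult below_image(1)[OF \<sigma> t_mono_K]) auto
  qed
  ultimately show ?thesis by (simp add: Hom_units_def)
qed

lemma leading_coeff_mult:
  assumes \<sigma>: "\<sigma> \<in> carrier (vAut K)" "snd (Phi K \<sigma>) = id" "\<And>c. \<sigma> (t_mono 0 c) = t_mono 0 c"
    and \<sigma>': "\<sigma>' \<in> carrier (vAut K)" "snd (Phi K \<sigma>') = id"
  shows "leading_coeff (\<sigma> \<otimes>\<^bsub>vAut K\<^esub> \<sigma>') = (\<lambda>g. leading_coeff \<sigma> g * leading_coeff \<sigma>' g)"
proof
  fix g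
  have "\<sigma> (\<sigma>' (t_mono g 1)) g = \<sigma>' (t_mono g 1) g * leading_coeff \<sigma> g"
    by (intro leading_image \<sigma> vAut_closed[OF \<sigma>'(1)] t_mono_K below_image(1)[OF \<sigma>' t_mono_K]) auto
  then show "leading_coeff (\<sigma> \<otimes>\<^bsub>vAut K\<^esub> \<sigma>') g = leading_coeff \<sigma> g * leading_coeff \<sigma>' g"
    by (simp add: leading_coeff_def vAut_mult_apply \<sigma>(1) \<sigma>'(1) t_mono_K)
qed

section \<open>Homomorphisms into the 1-units as automorphisms\<close>

lemma tau_map_t_mono: "tau_map K u (t_mono g c) = t_mono g c \<otimes>\<^bsub>hahn\<^esub> u g"
proof (cases "c = 0")
  case True
  have "tau_map K u (\<lambda>_. 0) = (\<lambda>_. 0)"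
    by (simp add: tau_map_def zero_K supp_def family_sum_empty_or_singleton(1))
  with True show ?thesis by (simp add: t_mono_mult del: t_mono_0) simp
next
  case False
  then show ?thesis
    by (simp add: tau_map_def t_mono_K supp_t_mono family_sum_empty_or_singleton(2))
qed

text \<open>\<open>u\<close> is recovered from the images of the monomials, \<open>\<tau>\<^sub>u t\<^sup>g = t\<^sup>g u(g)\<close>.\<close>

lemma tau_map_inj: "inj_on (tau_map K) (carrier (Hom_plus K))"
proof (rule inj_onI, rule ext)
  fix u w g assume "tau_map K u = tau_map K w"
  then show "u g = w g"
    by (metis tau_map_t_mono t_mono_mult_cancel)
qed

lemma Hom_plus_carrier:
  "u \<in> carrier (Hom_plus K) \<longleftrightarrow> (\<forall>g. u g \<in> one_units K) \<and>
     (\<forall>g h. u (g + h) = u g \<otimes>\<^bsub>hahn\<^esub> u h) \<and>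
     (\<forall>a\<in>K. K_summable K (supp a) (\<lambda>g. t_mono g (a g) \<otimes>\<^bsub>hahn\<^esub> u g))"
  by (simp add: Hom_plus_def)

text \<open>Recovers \<open>u\<close> from an automorphism. The quotients \<open>u(g) = t\<^sup>-\<^sup>g \<sigma>(t\<^sup>g)\<close> are multiplicative in \<open>g\<close> and are 1-units
  because \<open>\<sigma> t\<^sup>g\<close> has leading term \<open>t\<^sup>g\<close>. Summability of \<open>\<sigma>\<close> says precisely that \<open>u\<close> belongs to
  \<open>Hom_plus K\<close> and that \<open>\<sigma>\<close>, being determined by its values on monomials, is \<open>\<tau>\<^sub>u\<close>.\<close>

lemma unit_leading_coeff_is_tau_map:
  assumes \<sigma>: "\<sigma> \<in> carrier (vAut K)" "snd (Phi K \<sigma>) = id" "\<And>c. \<sigma> (t_mono 0 c) = t_mono 0 c"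
    and sum: "K_summable_map K \<sigma>" and lead: "leading_coeff \<sigma> = (\<lambda>_. 1)"
  defines "u \<equiv> (\<lambda>g. shift g (\<sigma> (t_mono g 1)))"
  shows "u \<in> carrier (Hom_plus K)" "tau_map K u = \<sigma>"
proof -
  have monomial: "t_mono g c \<otimes>\<^bsub>hahn\<^esub> u g = \<sigma> (t_mono g c)" for g c
    unfolding u_def t_mono_mult_shift vAut_t_mono[OF \<sigma>(1,3), of g c] ..
  have "u g \<in> one_units K" for g
  proof -
    have "\<sigma> (t_mono g 1) h = 0" if "h < g" for h
      using below_image(1)[OF \<sigma>(1,2) t_mono_K, of g g 1 h] that by simp
    moreover have "\<sigma> (t_mono g 1) g = 1"
      using fun_cong[OF lead, of g] by (simp add: leading_coeff_def)
    ultimately show ?thesis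
      unfolding one_units_iff u_def
      by (simp add: shift_K vAut_closed \<sigma>(1) t_mono_K) (simp add: shift_def)
  qed
  moreover have "u (g + h) = u g \<otimes>\<^bsub>hahn\<^esub> u h" for g h
    using vAut_mult[OF \<sigma>(1) t_mono_K t_mono_K, of g 1 h 1]
    by (simp add: u_def t_mono_mult_t_mono shift_mult)
  ultimately show "u \<in> carrier (Hom_plus K)"
    using sum by (simp add: Hom_plus_carrier monomial K_summable_map_def)
  show "tau_map K u = \<sigma>"
  proof (rule extensionalityI[of _ K])
    show "\<sigma> \<in> extensional K" by (rule vAut_extensional[OF \<sigma>(1)])
    show "tau_map K u a = \<sigma> a" if "a \<in> K" for a
      using that sum by (simp add: tau_map_def monomial K_summable_map_def)
  qed (simp add: tau_map_def)
qed

text \<open>The coefficient of \<open>\<sigma> a\<close> at \<open>h\<close> depends on \<open>a\<close> only through its coefficient at \<open>\<theta> h\<close>. So the images of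
  the terms of \<open>a\<close> have disjoint supports, nothing cancels in their sum, and the union of the
  supports is the support of \<open>\<sigma> a\<close>, which is well ordered. Both \<open>\<rho>\<^sub>x\<close> and the canonical lifts have
  this form.\<close>

lemma monomial_K_summable_map:
  assumes closed: "\<And>a. a \<in> K \<Longrightarrow> \<sigma> a \<in> K"
    and eq: "\<And>a. a \<in> K \<Longrightarrow> \<sigma> a = (\<lambda>h. m h (a (\<theta> h)))" and zero: "\<And>h. m h 0 = 0"
  shows "K_summable_map K \<sigma>"
  unfolding K_summable_map_def
proof
  fix a assume a: "a \<in> K"
  let ?A = "\<lambda>g. \<sigma> (t_mono g (a g))"
  have A: "?A g h = (if \<theta> h = g then m h (a g) else 0)" for g h
    by (simp add: eq[OF t_mono_K]) (simp add: zero t_mono_def)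
  have supp: "h \<in> supp (?A g) \<longleftrightarrow> \<theta> h = g \<and> m h (a (\<theta> h)) \<noteq> 0" for g h
    by (auto simp: supp_def A)
  have a0: "\<theta> h \<in> supp a" if "m h (a (\<theta> h)) \<noteq> 0" for h
    using that zero by (auto simp: supp_def)
  have "(\<Union>g\<in>supp a. supp (?A g)) = supp (\<sigma> a)"
    using a0 by (auto simp: supp) (auto simp: supp_def eq[OF a])
  then have "well_ordered (\<Union>g\<in>supp a. supp (?A g))"
    by (simp add: K_well_ordered closed a)
  moreover have index: "{g \<in> supp a. h \<in> supp (?A g)} = (if m h (a (\<theta> h)) = 0 then {} else {\<theta> h})" for h
    using a0 by (auto simp: supp)
  moreover have sum: "\<sigma> a = family_sum (supp a) ?A"
    unfolding family_sum_def index by (rule ext) (simp add: eq[OF a] A)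
  ultimately show "K_summable K (supp a) ?A \<and> \<sigma> a = family_sum (supp a) ?A"
    unfolding K_summable_def summable_family_def
    using closed[OF a] closed[OF t_mono_K] by (auto simp: index simp flip: sum)
qed

end

section \<open>The split extensions\<close>

locale lifted_hahn_field = hahn_subfield K
  for K :: "('g::linordered_ab_group_add, 'k::field) series set" +
  fixes \<Psi> :: "('k \<Rightarrow> 'k) \<times> ('g \<Rightarrow> 'g) \<Rightarrow> ('g, 'k) series \<Rightarrow> ('g, 'k) series"
  assumes first: "first_lifting K \<Psi>"
    and second: "canonical_second_lifting K"
    and stab_group: "group (vAut_plus_stab K)"
    and tau_strong: "\<forall>u\<in>carrier (Hom_plus K). strongly_additive K (tau_map K u)"
    and ext_stab: "\<not> canonical_first_lifting K \<longrightarrow> ExtAut \<Psi> \<subseteq> carrier (vAut_plus_stab K)"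
begin

abbreviation Aut_pair :: "(('k \<Rightarrow> 'k) \<times> ('g \<Rightarrow> 'g)) monoid" where
  "Aut_pair \<equiv> field_Aut \<times>\<times> order_Aut"

abbreviation stab where "stab \<equiv> carrier (vAut_plus_stab K)"

lemma group_Aut_pair: "group Aut_pair"
  by (rule DirProd_group[OF group_field_Aut group_order_Aut])

lemma stab_eq: "vAut_plus_stab K = (vAut K)\<lparr>carrier := stab\<rparr>"
  by (simp add: vAut_plus_stab_def)

lemma stab_iff:
  "\<sigma> \<in> stab \<longleftrightarrow> \<sigma> \<in> carrier (vAut K) \<and> \<sigma> ` constants = constants \<and> strongly_additive K \<sigma>"
  by (simp add: vAut_plus_stab_def)

lemma subgroup_stab: "subgroup stab (vAut K)"
  using stab_group by (intro vAut.group_incl_imp_subgroup) (auto simp: vAut_plus_stab_def)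

lemma stab_summable: "\<sigma> \<in> stab \<Longrightarrow> K_summable_map K \<sigma>"
  by (simp add: stab_iff strongly_additive_def)

text \<open>Stabilising the constants means that the constant term describes \<open>\<sigma>\<close> on \<open>k\<close> completely; without
  this the first component of \<open>Phi\<close> only sees \<open>\<sigma>\<close> on \<open>k\<close> modulo series of positive value.\<close>

lemma stab_const:
  assumes "\<sigma> \<in> stab"
  shows "\<sigma> (t_mono 0 c) = t_mono 0 (fst (Phi K \<sigma>) c)"
proof -
  have "\<sigma> (t_mono 0 c) \<in> constants" using assms by (auto simp: stab_iff constants_def)
  then obtain d where "\<sigma> (t_mono 0 c) = t_mono 0 d" by (auto simp: constants_def)
  then show ?thesis by (simp add: Phi_def)
qed

lemma fst_Phi_field_Aut:
  assumes \<sigma>: "\<sigma> \<in> stab"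
  shows "fst (Phi K \<sigma>) \<in> carrier field_Aut"
proof -
  let ?\<rho> = "fst (Phi K \<sigma>)"
  have A: "\<sigma> \<in> carrier (vAut K)" using \<sigma> by (simp add: stab_iff)
  have t_inj: "c = d" if "t_mono (0::'g) c = t_mono 0 d" for c d :: 'k
    using fun_cong[OF that, of 0] by simp
  have "inj ?\<rho>"
  proof (rule injI)
    fix c d assume "?\<rho> c = ?\<rho> d"
    then have "\<sigma> (t_mono 0 c) = \<sigma> (t_mono 0 d)" by (simp add: stab_const \<sigma>)
    then show "c = d"
      using t_inj vAut_bij[OF A] t_mono_K by (metis bij_betw_imp_inj_on inj_onD)
  qed
  moreover have "surj ?\<rho>"
    unfolding surj_def
  proof
    fix d
    have "t_mono 0 d \<in> \<sigma> ` constants" using \<sigma> by (simp add: stab_iff constants_def)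
    then obtain c where "t_mono 0 d = \<sigma> (t_mono 0 c)" by (auto simp: constants_def)
    then show "\<exists>c. d = ?\<rho> c" using t_inj stab_const[OF \<sigma>] by metis
  qed
  moreover have "?\<rho> (c + d) = ?\<rho> c + ?\<rho> d" for c d
  proof -
    have "t_mono 0 (c + d) = (\<lambda>g. t_mono 0 c g + (t_mono 0 d :: ('g, 'k) series) g)"
      by (auto simp: t_mono_def)
    then show ?thesis using vAut_add[OF A t_mono_K t_mono_K, of 0 c 0 d] by (simp add: Phi_def)
  qed
  moreover have "?\<rho> (c * d) = ?\<rho> c * ?\<rho> d" for c d
  proof -
    have "t_mono 0 (?\<rho> (c * d)) = \<sigma> (t_mono 0 c \<otimes>\<^bsub>hahn\<^esub> t_mono 0 d)"
      by (simp only: t_mono_mult_t_mono stab_const[OF \<sigma>] add_0_right)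
    also have "\<dots> = t_mono 0 (?\<rho> c * ?\<rho> d)"
      by (subst vAut_mult[OF A t_mono_K t_mono_K])
        (simp only: stab_const[OF \<sigma>] t_mono_mult_t_mono add_0_right)
    finally show ?thesis by (rule t_inj)
  qed
  moreover have "?\<rho> 1 = 1" using vAut_one[OF A] by (simp add: Phi_def)
  ultimately show ?thesis by (simp add: field_Aut_carrier bij_def)
qed

lemma Phi_hom: "Phi K \<in> hom ((vAut K)\<lparr>carrier := stab\<rparr>) Aut_pair"
proof (rule homI)
  fix \<sigma> assume "\<sigma> \<in> carrier ((vAut K)\<lparr>carrier := stab\<rparr>)"
  then have \<sigma>: "\<sigma> \<in> stab" by simp
  then have "snd (Phi K \<sigma>) \<in> carrier order_Aut"
    using vAut_induces by (auto simp: stab_iff induces_def)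
  with fst_Phi_field_Aut[OF \<sigma>] show "Phi K \<sigma> \<in> carrier Aut_pair"
    by (simp add: mem_Times_iff)
next
  fix \<sigma> \<sigma>'
  assume "\<sigma> \<in> carrier ((vAut K)\<lparr>carrier := stab\<rparr>)" "\<sigma>' \<in> carrier ((vAut K)\<lparr>carrier := stab\<rparr>)"
  then have s: "\<sigma> \<in> stab" "\<sigma>' \<in> stab" by simp_all
  then have v: "\<sigma> \<in> carrier (vAut K)" "\<sigma>' \<in> carrier (vAut K)" by (simp_all add: stab_iff)
  have "fst (Phi K (\<sigma> \<otimes>\<^bsub>vAut K\<^esub> \<sigma>')) = fst (Phi K \<sigma>) \<circ> fst (Phi K \<sigma>')"
  proof
    fix c
    have "(\<sigma> \<otimes>\<^bsub>vAut K\<^esub> \<sigma>') (t_mono 0 c) = t_mono 0 (fst (Phi K \<sigma>) (fst (Phi K \<sigma>') c))"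
      by (simp only: vAut_mult_apply[OF v t_mono_K] stab_const s)
    then show "fst (Phi K (\<sigma> \<otimes>\<^bsub>vAut K\<^esub> \<sigma>')) c = (fst (Phi K \<sigma>) \<circ> fst (Phi K \<sigma>')) c"
      by (simp add: Phi_def[of K "\<sigma> \<otimes>\<^bsub>vAut K\<^esub> \<sigma>'"])
  qed
  then have "Phi K (\<sigma> \<otimes>\<^bsub>vAut K\<^esub> \<sigma>') = Phi K \<sigma> \<otimes>\<^bsub>Aut_pair\<^esub> Phi K \<sigma>'"
    using s v vAut_induces
    by (simp add: mult_DirProd' field_Aut_mult fst_Phi_field_Aut order_Aut_mult snd_Phi_mult
        prod_eq_iff induces_def)
  then show "Phi K (\<sigma> \<otimes>\<^bsub>(vAut K)\<lparr>carrier := stab\<rparr>\<^esub> \<sigma>') = Phi K \<sigma> \<otimes>\<^bsub>Aut_pair\<^esub> Phi K \<sigma>'" by simp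
qed

lemma one_Aut_pair: "\<one>\<^bsub>Aut_pair\<^esub> = (id, id)"
  by simp

text \<open>The strongly additive elements of \<open>IntAut K\<close> that stabilise \<open>k\<close>. They fix \<open>k\<close> pointwise, which is
  why the same normal factor serves for both groups in the theorem.\<close>

definition inner where "inner = {\<sigma> \<in> stab. Phi K \<sigma> = \<one>\<^bsub>Aut_pair\<^esub>}"

lemma subgroup_inner: "subgroup inner (vAut K)"
proof -
  interpret P: group_hom "(vAut K)\<lparr>carrier := stab\<rparr>" Aut_pair "Phi K"
    using Phi_hom group_Aut_pair subgroup.subgroup_is_group[OF subgroup_stab group_vAut]
    by (simp add: group_hom_def group_hom_axioms_def)
  have "inner = kernel ((vAut K)\<lparr>carrier := stab\<rparr>) Aut_pair (Phi K)"
    by (simp add: inner_def kernel_def)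
  then show ?thesis
    using vAut.incl_subgroup[OF subgroup_stab] P.subgroup_kernel by simp
qed

lemma inner_simps:
  assumes "\<sigma> \<in> inner"
  shows "\<sigma> \<in> carrier (vAut K)" "\<sigma> \<in> stab" "snd (Phi K \<sigma>) = id" "\<sigma> (t_mono 0 c) = t_mono 0 c"
  using assms stab_const[of \<sigma> c] by (auto simp: inner_def one_Aut_pair stab_iff)

text \<open>The last two conditions are the coefficient form of \<open>v(\<sigma> t\<^sup>g) = g\<close>, so \<open>\<sigma>\<close> induces the identity
  on \<open>G\<close>.\<close>

lemma innerI:
  assumes \<sigma>: "\<sigma> \<in> carrier (vAut K)" "strongly_additive K \<sigma>" "\<And>c. \<sigma> (t_mono 0 c) = t_mono 0 c"
    and lead: "\<And>g. \<sigma> (t_mono g 1) g \<noteq> 0" "\<And>g h. h < g \<Longrightarrow> \<sigma> (t_mono g 1) h = 0"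
  shows "\<sigma> \<in> inner"
proof -
  have "\<sigma> ` constants = constants" by (simp add: constants_def image_image \<sigma>)
  moreover have "snd (Phi K \<sigma>) = id"
  proof
    fix g
    have "val (\<sigma> (t_mono g 1)) = g" using lead by (rule val_eqI)
    then show "snd (Phi K \<sigma>) g = id g"
      using induces_unique[OF vAut_induces[OF \<sigma>(1)], of g] by simp
  qed
  moreover have "fst (Phi K \<sigma>) = id" by (simp add: Phi_def \<sigma> fun_eq_iff)
  ultimately show ?thesis
    unfolding inner_def stab_iff one_Aut_pair using \<sigma> by (simp add: prod_eq_iff)
qed

lemma leading_coeff_hom: "leading_coeff \<in> hom ((vAut K)\<lparr>carrier := inner\<rparr>) Hom_units"
  by (rule homI)
    (simp_all add: inner_simps leading_coeff_Hom_units leading_coeff_mult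
      Hom_units_def[THEN arg_cong[where f = monoid.mult]])

text \<open>As \<open>\<tau>\<^sub>u\<close> is a ring homomorphism, \<open>u(0) = \<tau>\<^sub>u(1) = 1\<close>, and this makes it fix the constants.\<close>

lemma tau_map_inner:
  assumes u: "u \<in> carrier (Hom_plus K)"
  shows "tau_map K u \<in> inner" "leading_coeff (tau_map K u) = (\<lambda>_. 1)"
proof -
  have strong: "strongly_additive K (tau_map K u)" using tau_strong u by blast
  then have A: "tau_map K u \<in> carrier (vAut K)" by (simp add: strongly_additive_def)
  have unit: "u g \<in> K" "u g 0 = 1" "h < 0 \<Longrightarrow> u g h = 0" for g h
    using u by (auto simp: Hom_plus_carrier one_units_iff)
  have t: "tau_map K u (t_mono g c) h = c * u g (h - g)" for g c h
    by (simp add: tau_map_t_mono t_mono_mult)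
  have "u 0 = t_mono 0 1"
    using vAut_one[OF A] by (simp add: fun_eq_iff t)
  then have const: "tau_map K u (t_mono 0 c) = t_mono 0 c" for c
    by (simp add: tau_map_t_mono t_mono_mult_t_mono)
  show "tau_map K u \<in> inner"
    by (rule innerI[OF A strong const]) (simp_all add: t unit)
  show "leading_coeff (tau_map K u) = (\<lambda>_. 1)"
    by (simp add: leading_coeff_def t unit)
qed

lemma tau_map_image: "tau_map K ` carrier (Hom_plus K) = {\<sigma> \<in> inner. leading_coeff \<sigma> = \<one>\<^bsub>Hom_units\<^esub>}"
proof (intro subset_antisym subsetI)
  fix \<sigma> assume "\<sigma> \<in> {\<sigma> \<in> inner. leading_coeff \<sigma> = \<one>\<^bsub>Hom_units\<^esub>}"
  then have \<sigma>: "\<sigma> \<in> inner" "leading_coeff \<sigma> = (\<lambda>_. 1)" by (simp_all add: Hom_units_def)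
  note unit_leading_coeff_is_tau_map[OF inner_simps(1,3,4)[OF \<sigma>(1)] stab_summable[OF inner_simps(2)[OF \<sigma>(1)]] \<sigma>(2)]
  then show "\<sigma> \<in> tau_map K ` carrier (Hom_plus K)" by (metis imageI)
qed (auto simp: tau_map_inner Hom_units_def)

text \<open>The operation on \<open>Hom_plus K\<close> is composition of the automorphisms in disguise. Closure is obtained
  from this: the composite is again strongly additive because the stabiliser is a group, so it is
  \<open>\<tau>\<^sub>z\<close> for some \<open>z\<close>, and evaluating at \<open>t\<^sup>g\<close> identifies \<open>z\<close> as the product.\<close>

lemma tau_map_mult:
  assumes u: "u \<in> carrier (Hom_plus K)" and w: "w \<in> carrier (Hom_plus K)"
  shows "u \<otimes>\<^bsub>Hom_plus K\<^esub> w \<in> carrier (Hom_plus K)"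
    and "tau_map K (u \<otimes>\<^bsub>Hom_plus K\<^esub> w) = tau_map K u \<otimes>\<^bsub>vAut K\<^esub> tau_map K w"
proof -
  let ?s = "tau_map K u \<otimes>\<^bsub>vAut K\<^esub> tau_map K w"
  have A: "tau_map K u \<in> carrier (vAut K)" "tau_map K w \<in> carrier (vAut K)"
    using tau_map_inner u w inner_simps by blast+
  have "?s \<in> inner" "leading_coeff ?s = (\<lambda>_. 1)"
    using subgroup.m_closed[OF subgroup_inner tau_map_inner(1)[OF u] tau_map_inner(1)[OF w]]
    by (simp_all add: leading_coeff_mult inner_simps tau_map_inner u w)
  then have "?s \<in> tau_map K ` carrier (Hom_plus K)"
    by (simp add: tau_map_image Hom_units_def)
  then obtain z where z: "z \<in> carrier (Hom_plus K)" "?s = tau_map K z" by blast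
  have wK: "w g \<in> K" for g using w by (auto simp: Hom_plus_carrier one_units_iff)
  have "z = u \<otimes>\<^bsub>Hom_plus K\<^esub> w"
  proof
    fix g
    have "t_mono g 1 \<otimes>\<^bsub>hahn\<^esub> z g = tau_map K u (tau_map K w (t_mono g 1))"
      using vAut_mult_apply[OF A t_mono_K] by (simp add: z tau_map_t_mono)
    also have "\<dots> = (t_mono g 1 \<otimes>\<^bsub>hahn\<^esub> u g) \<otimes>\<^bsub>hahn\<^esub> tau_map K u (w g)"
      by (simp add: tau_map_t_mono vAut_mult[OF A(1)] t_mono_K wK)
    (* The exponents are split as g + 0 so that the factor t^g is removed from the first factor only. *)
    finally have "shift g (t_mono g 1 \<otimes>\<^bsub>hahn\<^esub> z g)
        = shift (g + 0) ((t_mono g 1 \<otimes>\<^bsub>hahn\<^esub> u g) \<otimes>\<^bsub>hahn\<^esub> tau_map K u (w g))" by simp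
    then have "z g = u g \<otimes>\<^bsub>hahn\<^esub> tau_map K u (w g)"
      unfolding shift_mult by (simp add: shift_def t_mono_mult)
    also have "\<dots> = tau_map K u (w g) \<otimes>\<^bsub>hahn\<^esub> u g"
      using subcring.sub_m_comm[of K hahn] K u vAut_closed[OF A(1) wK]
      by (auto simp: hahn_field_def subfield_def subdomain_def Hom_plus_carrier one_units_iff)
    finally show "z g = (u \<otimes>\<^bsub>Hom_plus K\<^esub> w) g" by (simp add: Hom_plus_def)
  qed
  with z show "u \<otimes>\<^bsub>Hom_plus K\<^esub> w \<in> carrier (Hom_plus K)" "tau_map K (u \<otimes>\<^bsub>Hom_plus K\<^esub> w) = ?s"
    by simp_all
qed

lemma group_hom_leading_coeff: "group_hom ((vAut K)\<lparr>carrier := inner\<rparr>) Hom_units leading_coeff"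
  using leading_coeff_hom group_Hom_units subgroup.subgroup_is_group[OF subgroup_inner group_vAut]
  by (simp add: group_hom_def group_hom_axioms_def)

lemma subgroup_tau_image: "subgroup (tau_map K ` carrier (Hom_plus K)) (vAut K)"
proof -
  interpret L: group_hom "(vAut K)\<lparr>carrier := inner\<rparr>" Hom_units leading_coeff
    by (rule group_hom_leading_coeff)
  have "tau_map K ` carrier (Hom_plus K) = kernel ((vAut K)\<lparr>carrier := inner\<rparr>) Hom_units leading_coeff"
    by (simp add: tau_map_image kernel_def)
  then show ?thesis
    using vAut.incl_subgroup[OF subgroup_inner] L.subgroup_kernel by simp
qed

text \<open>The identity is the image of some \<open>z\<close>, as the image is a subgroup; evaluating at \<open>t\<^sup>g\<close> gives \<open>z(g) = 1\<close>.\<close>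

lemma tau_map_one:
  shows "\<one>\<^bsub>Hom_plus K\<^esub> \<in> carrier (Hom_plus K)" and "tau_map K \<one>\<^bsub>Hom_plus K\<^esub> = \<one>\<^bsub>vAut K\<^esub>"
proof -
  have "\<one>\<^bsub>vAut K\<^esub> \<in> tau_map K ` carrier (Hom_plus K)"
    using subgroup_tau_image by (rule subgroup.one_closed)
  then obtain z where z: "z \<in> carrier (Hom_plus K)" "\<one>\<^bsub>vAut K\<^esub> = tau_map K z" by blast
  have "z = \<one>\<^bsub>Hom_plus K\<^esub>"
  proof
    fix g
    have "t_mono g 1 \<otimes>\<^bsub>hahn\<^esub> z g = t_mono g 1"
      using fun_cong[OF z(2), of "t_mono g 1"] by (simp add: tau_map_t_mono vAut_one_eq t_mono_K)
    also have "\<dots> = t_mono g 1 \<otimes>\<^bsub>hahn\<^esub> t_mono 0 1" by (simp add: mult_t_mono_0_1)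
    finally show "z g = \<one>\<^bsub>Hom_plus K\<^esub> g"
      using t_mono_mult_cancel by (fastforce simp: Hom_plus_def hahn_simps)
  qed
  with z show "\<one>\<^bsub>Hom_plus K\<^esub> \<in> carrier (Hom_plus K)" "tau_map K \<one>\<^bsub>Hom_plus K\<^esub> = \<one>\<^bsub>vAut K\<^esub>"
    by simp_all
qed

lemma group_Hom_plus: "group (Hom_plus K)"
  by (rule group_if_embedded[where f = "tau_map K", OF group_vAut subgroup_tau_image tau_map_inj])
    (simp_all add: tau_map_one tau_map_mult)

lemma rho_map_hom: "rho_map K \<in> hom Hom_units (vAut K)"
  using second by (auto simp: canonical_second_lifting_def IntAut_def hom_def kernel_def)

text \<open>In the image of a homomorphism the inverses are again of the form \<open>\<psi> h\<close>, so summability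
  of all \<open>\<psi> h\<close> already gives strong additivity.\<close>

lemma strongly_additive_if_hom:
  assumes "group H" "\<psi> \<in> hom H (vAut K)" "\<And>h. h \<in> carrier H \<Longrightarrow> K_summable_map K (\<psi> h)" "h \<in> carrier H"
  shows "strongly_additive K (\<psi> h)"
proof -
  interpret P: group_hom H "vAut K" \<psi>
    using assms group_vAut by (simp add: group_hom_def group_hom_axioms_def)
  show ?thesis
    using assms by (simp add: strongly_additive_def flip: P.hom_inv)
qed

lemma rho_map_t_mono: "rho_map K x (t_mono g c) = t_mono g (c * x g)"
  by (simp add: rho_map_def t_mono_K) (auto simp: t_mono_def)

lemma rho_map_inner:
  assumes x: "x \<in> carrier Hom_units"
  shows "rho_map K x \<in> inner"
proof (rule innerI)
  show "strongly_additive K (rho_map K x)"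
  proof (rule strongly_additive_if_hom[OF group_Hom_units rho_map_hom _ x])
    fix y :: "'g \<Rightarrow> 'k" assume y: "y \<in> carrier Hom_units"
    show "K_summable_map K (rho_map K y)"
    proof (rule monomial_K_summable_map[where m = "\<lambda>h c. c * y h" and \<theta> = id])
      show "rho_map K y a \<in> K" if "a \<in> K" for a
        using that y rho_map_hom by (simp add: hom_in_carrier vAut_closed)
    qed (simp_all add: rho_map_def)
  qed
qed (use x rho_map_hom in \<open>auto simp: hom_in_carrier rho_map_t_mono Hom_units_zero, simp add: Hom_units_def\<close>)

lemma leading_coeff_rho_map: "leading_coeff (rho_map K x) = x"
  by (simp add: leading_coeff_def rho_map_t_mono)

text \<open>\<open>inner\<close> is an extension of \<open>Hom(G, k\<^sup>\<times>)\<close> by \<open>Hom\<^sup>+(G, 1 + I\<^sub>K)\<close>: the quotient map takes leading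
  coefficients and \<open>x \<mapsto> \<rho>\<^sub>x\<close> splits it.\<close>

lemma split_units:
  "split_extension (vAut K) inner (Hom_plus K) Hom_units (tau_map K) leading_coeff (rho_map K)"
proof (rule split_extension.intro)
  show "tau_map K \<in> hom (Hom_plus K) (vAut K)"
    by (rule homI) (simp_all add: tau_map_mult tau_map_inner inner_simps)
qed (simp_all add: group_vAut subgroup_inner group_Hom_plus group_Hom_units tau_map_inj tau_map_image
    leading_coeff_hom rho_map_hom rho_map_inner leading_coeff_rho_map)

sublocale units: split_extension "vAut K" inner "Hom_plus K" Hom_units "tau_map K" leading_coeff "rho_map K"
  by (rule split_units)

lemma units_act: "units.act = act_units K"
  by (simp add: fun_eq_iff units.act_def act_units_def)

lemma units_product: "units.product_map = internal_map K"
  by (simp add: fun_eq_iff units.product_map_def internal_map_def)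

lemma \<Psi>_facts:
  "\<Psi> \<in> hom Aut_pair (vAut K)" "p \<in> carrier Aut_pair \<Longrightarrow> Phi K (\<Psi> p) = p"
  using first by (auto simp: first_lifting_def simp del: carrier_DirProd)

text \<open>A canonical \<open>\<Psi>\<close> lands in the stabiliser because its values map monomials to monomials; for any
  other \<open>\<Psi>\<close> this is the hypothesis on \<open>ExtAut \<Psi>\<close>.\<close>

lemma \<Psi>_stab:
  assumes p: "p \<in> carrier Aut_pair"
  shows "\<Psi> p \<in> stab"
proof (cases "canonical_first_lifting K")
  case False
  then show ?thesis using ext_stab p unfolding ExtAut_def by blast
next
  case True
  then have \<Psi>: "\<Psi> q = canonical_lift K q" if "q \<in> carrier Aut_pair" for q
    using first that by (simp add: first_lifting_def del: carrier_DirProd)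
  have "strongly_additive K (\<Psi> p)"
  proof (rule strongly_additive_if_hom[OF group_Aut_pair \<Psi>_facts(1) _ p])
    fix q assume q: "q \<in> carrier Aut_pair"
    show "K_summable_map K (\<Psi> q)"
    proof (rule monomial_K_summable_map[where m = "\<lambda>_. fst q" and \<theta> = "inv_into UNIV (snd q)"])
      show "\<Psi> q a \<in> K" if "a \<in> K" for a
        using that q hom_in_carrier[OF \<Psi>_facts(1)] vAut_closed by blast
      show "\<Psi> q a = (\<lambda>h. fst q (a (inv_into UNIV (snd q) h)))" if "a \<in> K" for a
        using that q by (simp add: \<Psi> canonical_lift_def del: carrier_DirProd)
      have "fst q \<in> carrier field_Aut" using q by auto
      then have "fst q (0 + 0) = fst q 0 + fst q 0" unfolding field_Aut_carrier by blast
      then show "fst q 0 = 0" by (simp only: add_0_right add_cancel_right_right)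
    qed
  qed
  moreover have "\<Psi> p ` constants = constants"
  proof -
    have "surj (fst p)" using p by (auto simp: field_Aut_carrier bij_is_surj)
    moreover have "\<Psi> p ` constants = t_mono 0 ` range (fst p)"
      using p by (simp add: constants_def image_image \<Psi> canonical_lift_t_mono_zero t_mono_K
          del: carrier_DirProd)
    ultimately show ?thesis by (simp add: constants_def)
  qed
  ultimately show ?thesis
    using p hom_in_carrier[OF \<Psi>_facts(1)] unfolding stab_iff by blast
qed

lemma group_internal: "group (internal K)"
  using units.group_semidirect by (simp add: internal_def units_act)

lemma internal_map_facts:
  "internal_map K \<in> hom (internal K) (vAut K)" "inj_on (internal_map K) (carrier (internal K))"
  "internal_map K ` carrier (internal K) = inner"
  using units.product_map_hom units.product_map_inj units.product_map_image
  by (simp_all add: internal_def units_act units_product)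

lemma split_stab: "split_extension (vAut K) stab (internal K) Aut_pair (internal_map K) (Phi K) \<Psi>"
  by (rule split_extension.intro)
    (simp_all add: group_vAut subgroup_stab group_internal group_Aut_pair internal_map_facts inner_def
      Phi_hom \<Psi>_facts \<Psi>_stab del: carrier_DirProd one_DirProd)

sublocale ext: split_extension "vAut K" stab "internal K" Aut_pair "internal_map K" "Phi K" \<Psi>
  by (rule split_stab)

lemma ext_act: "ext.act = act_ext K \<Psi>"
  by (simp add: fun_eq_iff ext.act_def act_ext_def)

abbreviation fixing where "fixing \<equiv> carrier (vAut_plus_fix K)"

text \<open>Relates the two subscripts: \<open>k\<close> is fixed pointwise iff it is stabilised and the induced automorphism
  of \<open>k\<close> is trivial. The order automorphism is then the only component of \<open>Phi\<close> left.\<close>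

lemma fixing_iff: "\<sigma> \<in> fixing \<longleftrightarrow> \<sigma> \<in> stab \<and> fst (Phi K \<sigma>) = id"
proof
  assume "\<sigma> \<in> fixing"
  then have f: "\<sigma> \<in> carrier (vAut K)" "strongly_additive K \<sigma>" "\<And>c. \<sigma> (t_mono 0 c) = t_mono 0 c"
    by (auto simp: vAut_plus_fix_def constants_def)
  then have "\<sigma> ` constants = constants" by (simp add: constants_def image_image)
  with f show "\<sigma> \<in> stab \<and> fst (Phi K \<sigma>) = id" by (simp add: stab_iff Phi_def fun_eq_iff)
next
  assume "\<sigma> \<in> stab \<and> fst (Phi K \<sigma>) = id"
  then show "\<sigma> \<in> fixing"
    using stab_const[of \<sigma>] by (auto simp: vAut_plus_fix_def stab_iff constants_def)
qed

lemma subgroup_fixing: "subgroup fixing (vAut K)"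
proof (rule vAut.subgroupI)
  show "fixing \<subseteq> carrier (vAut K)" by (auto simp: fixing_iff stab_iff)
  have "\<one>\<^bsub>vAut K\<^esub> \<in> fixing"
    using subgroup.one_closed[OF subgroup_inner] by (simp add: fixing_iff inner_def)
  then show "fixing \<noteq> {}" by blast
  fix \<sigma> assume \<sigma>: "\<sigma> \<in> fixing"
  then have \<sigma>': "\<sigma> \<in> stab" "fst (Phi K \<sigma>) = id" by (simp_all add: fixing_iff)
  then obtain \<tau> where \<tau>: "Phi K \<sigma> = (\<one>\<^bsub>field_Aut\<^esub>, \<tau>)" by (cases "Phi K \<sigma>") simp
  then have "\<tau> \<in> carrier order_Aut" using ext.\<pi>_closed[OF \<sigma>'(1)] by simp
  then have "Phi K (inv\<^bsub>vAut K\<^esub> \<sigma>) = (inv\<^bsub>field_Aut\<^esub> \<one>\<^bsub>field_Aut\<^esub>, inv\<^bsub>order_Aut\<^esub> \<tau>)"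
    unfolding ext.\<pi>_inv[OF \<sigma>'(1)] \<tau>
    by (intro inv_DirProd group_field_Aut group_order_Aut monoid.one_closed group.is_monoid)
  then have "fst (Phi K (inv\<^bsub>vAut K\<^esub> \<sigma>)) = id"
    using monoid.inv_one[OF group.is_monoid[OF group_field_Aut]] by simp
  then show "inv\<^bsub>vAut K\<^esub> \<sigma> \<in> fixing" using \<sigma> by (simp add: fixing_iff ext.S_closed)
next
  fix \<sigma> \<sigma>' assume "\<sigma> \<in> fixing" "\<sigma>' \<in> fixing"
  then show "\<sigma> \<otimes>\<^bsub>vAut K\<^esub> \<sigma>' \<in> fixing"
    by (simp add: fixing_iff ext.S_closed ext.\<pi>_mult mult_DirProd' field_Aut_mult field_Aut_carrier)
qed

lemma id_Aut_pair: "\<tau> \<in> carrier order_Aut \<Longrightarrow> (id, \<tau>) \<in> carrier Aut_pair"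
  by (simp add: field_Aut_carrier)

lemma split_fix:
  "split_extension (vAut K) fixing (internal K) order_Aut (internal_map K) (\<lambda>\<sigma>. snd (Phi K \<sigma>))
     (\<lambda>\<tau>. \<Psi> (id, \<tau>))"
proof (rule split_extension.intro)
  show "internal_map K ` carrier (internal K) = {\<sigma> \<in> fixing. snd (Phi K \<sigma>) = \<one>\<^bsub>order_Aut\<^esub>}"
    by (auto simp: internal_map_facts inner_def fixing_iff field_Aut_one order_Aut_one prod_eq_iff)
  show "(\<lambda>\<sigma>. snd (Phi K \<sigma>)) \<in> hom ((vAut K)\<lparr>carrier := fixing\<rparr>) order_Aut"
    using ext.\<pi>_closed ext.\<pi>_mult by (intro homI) (auto simp: fixing_iff mult_DirProd' mem_Times_iff)
  show "(\<lambda>\<tau>. \<Psi> (id, \<tau>)) \<in> hom order_Aut (vAut K)"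
  proof (rule homI)
    fix \<tau> \<tau>' :: "'g \<Rightarrow> 'g" assume \<tau>: "\<tau> \<in> carrier order_Aut" "\<tau>' \<in> carrier order_Aut"
    have "(id, \<tau> \<otimes>\<^bsub>order_Aut\<^esub> \<tau>') = (id, \<tau>) \<otimes>\<^bsub>Aut_pair\<^esub> (id, \<tau>')"
      by (simp add: field_Aut_mult field_Aut_carrier)
    then show "\<Psi> (id, \<tau> \<otimes>\<^bsub>order_Aut\<^esub> \<tau>') = \<Psi> (id, \<tau>) \<otimes>\<^bsub>vAut K\<^esub> \<Psi> (id, \<tau>')"
      using ext.\<psi>_mult[OF id_Aut_pair[OF \<tau>(1)] id_Aut_pair[OF \<tau>(2)]] by simp
  qed (use ext.\<psi>_carrier id_Aut_pair in blast)
qed (use id_Aut_pair in \<open>auto simp: group_vAut subgroup_fixing group_internal group_order_Aut internal_map_facts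
    fixing_iff \<Psi>_facts \<Psi>_stab simp del: carrier_DirProd\<close>)

sublocale ord: split_extension "vAut K" fixing "internal K" order_Aut "internal_map K"
    "\<lambda>\<sigma>. snd (Phi K \<sigma>)" "\<lambda>\<tau>. \<Psi> (id, \<tau>)"
  by (rule split_fix)

lemma ord_act: "ord.act = act_ext_order K \<Psi>"
  by (simp add: fun_eq_iff ord.act_def act_ext_order_def act_ext_def)

lemma fix_eq: "vAut_plus_fix K = (vAut K)\<lparr>carrier := fixing\<rparr>"
  by (simp add: vAut_plus_fix_def)

end

theorem theorem4p2p8:
  fixes K :: "('g::linordered_ab_group_add, 'k::field) series set"
    and \<Psi> :: "('k \<Rightarrow> 'k) \<times> ('g \<Rightarrow> 'g) \<Rightarrow> ('g, 'k) series \<Rightarrow> ('g, 'k) series"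
  assumes "hahn_field K"
    and "first_lifting K \<Psi>"
    and "canonical_second_lifting K"
    and "group (vAut_plus_stab K)"
    and "\<forall>u\<in>carrier (Hom_plus K). strongly_additive K (tau_map K u)"
    and "\<not> canonical_first_lifting K \<longrightarrow> ExtAut \<Psi> \<subseteq> carrier (vAut_plus_stab K)"
  shows "semidirect_action (Hom_plus K) Hom_units (act_units K)
    \<and> semidirect_action (internal K) (field_Aut \<times>\<times> order_Aut) (act_ext K \<Psi>)
    \<and> semidirect_action (internal K) order_Aut (act_ext_order K \<Psi>)
    \<and> vAut_plus_stab K \<cong> semidirect (internal K) (field_Aut \<times>\<times> order_Aut) (act_ext K \<Psi>)
    \<and> vAut_plus_fix K \<cong> semidirect (internal K) order_Aut (act_ext_order K \<Psi>)"
proof -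
  interpret lifted_hahn_field K \<Psi>
    using assms by (intro lifted_hahn_field.intro hahn_subfield.intro lifted_hahn_field_axioms.intro)
  show ?thesis
    using units.semidirect_action_act ext.semidirect_action_act ord.semidirect_action_act
      ext.iso_semidirect ord.iso_semidirect
    by (simp add: units_act ext_act ord_act flip: stab_eq fix_eq)
qed

end
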